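(* For every $c\in[2,\infty)$ and every $\epsilon>0$, the set of all maps $g\in\mathbb{G}$ that are Markov, locally eventually onto (LEO), and have entropy within $\epsilon$ of $c$, i.e. $|c_\lambda(g)-c|<\epsilon$, is dense in $C(\lambda)$ with respect to the uniform metric $\rho$.
   Context: $\lambda$ is Lebesgue measure on $[0,1]$. A continuous map $h:[0,1]\to[0,1]$ is $\lambda$-preserving if $\lambda(A)=\lambda(h^{-1}(A))$ for every Borel set $A\subseteq[0,1]$. $C(\lambda)$ is the set of all continuous $\lambda$-preserving maps $[0,1]\to[0,1]$. The metric is $\rho(h_1,h_2)=\sup_{x\in[0,1]}|h_1(x)-h_2(x)|$. A dyadic number is a rational number whose denominator is an integer power of $2$. $\mathbb{G}$ ($\lambda$-preserving Thompson's monoid) is the set of continuous maps $g$ from $[0,1]$ onto $[0,1]$ such that: $g$ is $\lambda$-preserving; $g$ is piecewise affine; $g$ is differentiable except at finitely many points; the $x$-coordinate of each point of non-differentiability is dyadic; and on every interval where $g$ is differentiable, the derivative is of the form $\pm 2^k$ with $k\in\mathbb{Z}$. The entropy of a map $h$ is $c_\lambda(h)=\int_0^1\log_2|h'(x)|\,d\lambda(x)$. A map $h$ is locally eventually onto (LEO) if for every nonempty open set $U$ in $[0,1]$ there is an integer $N$ with $h^N(U)=[0,1]$. A breakpoint of a piecewise affine map is an endpoint ($x=0$ or $x=1$) or a point at which the derivative is discontinuous; a piecewise affine map $h$ is Markov if every breakpoint $x$ is preperiodic, i.e. $h^n(x)=h^m(x)$ for some integers $n>m\ge0$. *)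

theory Defs
  imports "HOL-Analysis.Analysis"
begin

text \<open>Maps \<open>[0,1] \<rightarrow> [0,1]\<close> are extensional functions on \<open>{0..1}\<close>, so that equality of functions
  is equality of maps.\<close>

definition lambda_preserving :: "(real \<Rightarrow> real) \<Rightarrow> bool" where
  "lambda_preserving h \<longleftrightarrow>
     (\<forall>A. A \<in> sets borel \<and> A \<subseteq> {0..1} \<longrightarrow>
        emeasure (lebesgue_on {0..1}) A = emeasure (lebesgue_on {0..1}) (h -` A \<inter> {0..1}))"

definition C_lambda :: "(real \<Rightarrow> real) set" where
  "C_lambda = {h \<in> {0..1} \<rightarrow>\<^sub>E {0..1}. continuous_on {0..1} h \<and> lambda_preserving h}"

text \<open>The value \<open>0\<close> outside \<open>C_lambda\<close> is a convention needed because \<open>Metric_space\<close> requires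
  a distance function to be nonnegative and symmetric on the whole type.\<close>

definition rho :: "(real \<Rightarrow> real) \<Rightarrow> (real \<Rightarrow> real) \<Rightarrow> real" where
  "rho h1 h2 =
     (if h1 \<in> C_lambda \<and> h2 \<in> C_lambda then SUP x\<in>{0..1}. \<bar>h1 x - h2 x\<bar> else 0)"

definition dyadic :: "real \<Rightarrow> bool" where
  "dyadic x \<longleftrightarrow> (\<exists>(a::int) (k::nat). x = of_int a / 2 ^ k)"

text \<open>Derivatives are taken within \<open>{0..1}\<close>, i.e. they are one-sided at the two endpoints.
  \<open>der h x\<close> is meaningful only for \<open>x \<in> diff_points h\<close>.\<close>

definition diff_points :: "(real \<Rightarrow> real) \<Rightarrow> real set" where
  "diff_points h = {x \<in> {0..1}. h differentiable (at x within {0..1})}"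

definition der :: "(real \<Rightarrow> real) \<Rightarrow> real \<Rightarrow> real" where
  "der h x = vector_derivative h (at x within {0..1})"

definition piecewise_affine :: "(real \<Rightarrow> real) \<Rightarrow> bool" where
  "piecewise_affine h \<longleftrightarrow>
     (\<exists>F. finite F \<and>
        (\<forall>u v. 0 \<le> u \<and> u < v \<and> v \<le> 1 \<and> {u<..<v} \<inter> F = {} \<longrightarrow>
           (\<exists>m b. \<forall>x\<in>{u<..<v}. h x = m * x + b)))"

definition thompson_monoid :: "(real \<Rightarrow> real) set" where
  "thompson_monoid = {g \<in> C_lambda.
     g ` {0..1} = {0..1} \<and>
     piecewise_affine g \<and>
     finite ({0..1} - diff_points g) \<and>
     (\<forall>x \<in> {0..1} - diff_points g. dyadic x) \<and>
     (\<forall>u v. u < v \<and> {u<..<v} \<subseteq> diff_points g \<longrightarrow>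
        (\<exists>k::int. (\<forall>x\<in>{u<..<v}. der g x = 2 powi k) \<or>
                  (\<forall>x\<in>{u<..<v}. der g x = - (2 powi k))))}"

text \<open>The Bochner integral is \<open>0\<close> for non-integrable functions, and \<open>log 2 0 = 0\<close>; hence this is the
  entropy only for maps with \<open>log 2 \<bar>h'\<bar>\<close> integrable and \<open>h' \<noteq> 0\<close> almost everywhere, which
  includes all elements of \<open>thompson_monoid\<close>.\<close>

definition entropy_lambda :: "(real \<Rightarrow> real) \<Rightarrow> real" where
  "entropy_lambda h = (LINT x|lebesgue_on {0..1}. log 2 \<bar>der h x\<bar>)"

definition locally_eventually_onto :: "(real \<Rightarrow> real) \<Rightarrow> bool" where
  "locally_eventually_onto h \<longleftrightarrow>
     (\<forall>U. openin (top_of_set {0..1}) U \<and> U \<noteq> {} \<longrightarrow> (\<exists>N. (h ^^ N) ` U = {0..1}))"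

text \<open>A point where the derivative does not exist counts as a point where it is discontinuous.\<close>

definition breakpoint :: "(real \<Rightarrow> real) \<Rightarrow> real \<Rightarrow> bool" where
  "breakpoint h x \<longleftrightarrow> x = 0 \<or> x = 1 \<or>
     x \<in> {0..1} \<and>
     \<not> (x \<in> diff_points h \<and> continuous (at x within diff_points h) (der h))"

definition markov :: "(real \<Rightarrow> real) \<Rightarrow> bool" where
  "markov h \<longleftrightarrow> piecewise_affine h \<and>
     (\<forall>x. breakpoint h x \<longrightarrow> (\<exists>n m. n > m \<and> (h ^^ n) x = (h ^^ m) x))"

lemma C_lambda_diff_le:
  assumes "f \<in> C_lambda" "g \<in> C_lambda" "x \<in> {0..1}"
  shows "\<bar>f x - g x\<bar> \<le> 1"
proof -
  have "f x \<in> {0..1}" "g x \<in> {0..1}"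
    using assms by (auto simp: C_lambda_def PiE_iff simp del: atLeastAtMost_iff)
  then show ?thesis by auto
qed

lemma le_rho:
  assumes "f \<in> C_lambda" "g \<in> C_lambda" "x \<in> {0..1}"
  shows "\<bar>f x - g x\<bar> \<le> rho f g"
proof -
  have "\<bar>f x - g x\<bar> \<le> (SUP x\<in>{0..1}. \<bar>f x - g x\<bar>)"
    by (rule cSUP_upper[OF assms(3)])
       (auto intro!: bdd_aboveI2[where M = 1] C_lambda_diff_le[OF assms(1,2)])
  then show ?thesis using assms by (simp add: rho_def)
qed

lemma rho_le:
  assumes "f \<in> C_lambda" "g \<in> C_lambda" "\<And>x. x \<in> {0..1} \<Longrightarrow> \<bar>f x - g x\<bar> \<le> B"
  shows "rho f g \<le> B"
proof -
  have "(SUP x\<in>{0..1}. \<bar>f x - g x\<bar>) \<le> B"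
    by (rule cSUP_least) (use assms in auto)
  then show ?thesis using assms by (simp add: rho_def)
qed

lemma Metric_space_C_lambda: "Metric_space C_lambda rho"
proof
  fix f g
  show "0 \<le> rho f g"
  proof (cases "f \<in> C_lambda \<and> g \<in> C_lambda")
    case True
    have "0 \<le> \<bar>f 0 - g 0\<bar>" by simp
    also have "\<dots> \<le> rho f g" by (rule le_rho) (use True in auto)
    finally show ?thesis .
  qed (auto simp: rho_def)
  show "rho f g = rho g f"
    by (simp add: rho_def abs_minus_commute)
next
  fix f g assume fg: "f \<in> C_lambda" "g \<in> C_lambda"
  show "rho f g = 0 \<longleftrightarrow> f = g"
  proof
    assume "rho f g = 0"
    then have "f x = g x" if "x \<in> {0..1}" for x
      using le_rho[OF fg that] by simp
    moreover have "f \<in> {0..1} \<rightarrow>\<^sub>E {0..1}" "g \<in> {0..1} \<rightarrow>\<^sub>E {0..1}"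
      using fg by (simp_all add: C_lambda_def)
    ultimately show "f = g" by (rule PiE_ext[rotated 2])
  qed (simp add: rho_def)
next
  fix f g h assume fgh: "f \<in> C_lambda" "g \<in> C_lambda" "h \<in> C_lambda"
  show "rho f h \<le> rho f g + rho g h"
  proof (rule rho_le[OF fgh(1,3)])
    fix x :: real assume x: "x \<in> {0..1}"
    show "\<bar>f x - h x\<bar> \<le> rho f g + rho g h"
      using le_rho[OF fgh(1,2) x] le_rho[OF fgh(2,3) x] by linarith
  qed
qed

definition dense_in_C_lambda :: "(real \<Rightarrow> real) set \<Rightarrow> bool" where
  "dense_in_C_lambda S \<longleftrightarrow>
     S \<subseteq> C_lambda \<and> Metric_space.mtopology C_lambda rho closure_of S = C_lambda"

lemma dense_in_C_lambda_iff:
  "dense_in_C_lambda S \<longleftrightarrow>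
     S \<subseteq> C_lambda \<and> (\<forall>h\<in>C_lambda. \<forall>\<delta>>0. \<exists>g\<in>S. rho h g < \<delta>)"
proof -
  interpret Metric_space C_lambda rho by (rule Metric_space_C_lambda)
  show ?thesis
    unfolding dense_in_C_lambda_def metric_closure_of by (auto simp: in_mball; blast)
qed

end

theory Submission
  imports Defs
begin

text \<open>Divide \<open>[0,1]\<close> into \<open>n = 2\<^sup>m\<close> cells. Because \<open>h\<close> preserves \<open>\<lambda>\<close>, Hall's theorem gives a permutation
  \<open>\<sigma>\<close> of the cells such that the image of cell \<open>i\<close> meets cell \<open>\<sigma> i\<close>. The approximating map is a
  path of affine full crossings of cells with durations \<open>2\<^sup>-\<^sup>k / n\<close>: during time cell \<open>i\<close> it spends nearly
  all its time crossing cell \<open>\<sigma> i\<close>, with the durations \<open>1/2, 1/4, \<dots>\<close> in units of \<open>1/n\<close>, and uses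
  very short crossings to return and to travel to cell \<open>\<sigma> (i + 1)\<close>. If the durations of the crossings
  of each cell add up to \<open>1/n\<close>, the map preserves \<open>\<lambda>\<close>; its entropy is the mean of the Shannon
  entropies of these distributions, which can be tuned to any \<open>c \<ge> 2\<close>. Intervals grow under iteration
  until they contain a cell. Since time cell \<open>i\<close> also visits the neighbours of \<open>\<sigma> i\<close>, a union of
  cells, moved by \<open>\<sigma>\<close> and then enlarged by all neighbouring cells, grows until it is everything.\<close>

subsection \<open>Preliminaries on the real line\<close>

lemma emeasure_lborel_affine_vimage:
  fixes c t :: real
  assumes "c \<noteq> 0" "B \<in> sets borel"
  shows "emeasure lborel B = ennreal \<bar>c\<bar> * emeasure lborel ((\<lambda>x. t + c * x) -` B)"
proof -
  have [measurable]: "B \<in> sets borel" by fact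
  have m: "(\<lambda>x. t + c * x) -` B \<in> sets borel"
    by (rule measurable_sets_borel[OF _ assms(2)]) measurable
  have "emeasure lborel B = (\<integral>\<^sup>+x. indicator B x \<partial>lborel)" using assms by simp
  also have "\<dots> = ennreal \<bar>c\<bar> * (\<integral>\<^sup>+x. indicator B (t + c * x) \<partial>lborel)"
    by (rule nn_integral_real_affine) (use assms in auto)
  also have "(\<lambda>x. indicator B (t + c * x) :: ennreal) = indicator ((\<lambda>x. t + c * x) -` B)"
    by (auto simp: indicator_def)
  finally show ?thesis using m by simp
qed

lemma lift_Suc_less_bounded:
  fixes X :: "nat \<Rightarrow> 'a :: order"
  assumes "\<And>t. t < L \<Longrightarrow> X t < X (Suc t)" "i < j" "j \<le> L"
  shows "X i < X j"
  using assms(2,3)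
proof (induction j)
  case (Suc j)
  have "X j < X (Suc j)" using Suc.prems assms(1) by simp
  then show ?case using Suc by (cases "i = j") (auto intro: less_trans)
qed simp

lemma obtain_subinterval:
  fixes X :: "nat \<Rightarrow> 'a :: linorder"
  assumes "X 0 \<le> x" "x < X L"
  obtains t where "t < L" "X t \<le> x" "x < X (Suc t)"
  using ex_least_nat_less[of "\<lambda>t. x < X t" L] assms by (meson leD le_refl not_le)

text \<open>The finitely many nodes form a null set, so the open pieces carry all the measure. It
  serves twice: for the times \<open>X\<close> of a path and for the heights
  \<open>j / n\<close>.\<close>

lemma emeasure_lborel_subdivision:
  fixes X :: "nat \<Rightarrow> real"
  assumes X: "\<And>t. t < L \<Longrightarrow> X t < X (Suc t)"
    and B: "B \<in> sets borel" "B \<subseteq> {X 0..X L}"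
  shows "emeasure lborel B = (\<Sum>t<L. emeasure lborel (B \<inter> {X t<..<X (Suc t)}))"
proof -
  let ?F = "X ` {..L}"
  have mono: "X i \<le> X j" if "i \<le> j" "j \<le> L" for i j
    using lift_Suc_less_bounded[of L X i j] X that by (cases "i = j") (auto simp: less_imp_le)
  have "emeasure lborel B = emeasure lborel (B - ?F)"
    by (rule emeasure_Diff_null_set[symmetric]) (use B in \<open>auto intro: finite_imp_null_set_lborel\<close>)
  also have "B - ?F = (\<Union>t<L. B \<inter> {X t<..<X (Suc t)})"
  proof (intro equalityI subsetI)
    fix x assume x: "x \<in> B - ?F"
    then have "X 0 \<le> x" "x < X L" using B by (auto simp: order_le_less)
    then obtain t where t: "t < L" "X t \<le> x" "x < X (Suc t)" by (rule obtain_subinterval)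
    moreover have "x \<noteq> X t" using x t by auto
    ultimately show "x \<in> (\<Union>t<L. B \<inter> {X t<..<X (Suc t)})" using x by auto
  next
    fix x assume "x \<in> (\<Union>t<L. B \<inter> {X t<..<X (Suc t)})"
    then obtain t where t: "t < L" "x \<in> B" "X t < x" "x < X (Suc t)" by auto
    have "x \<noteq> X j" if "j \<le> L" for j
    proof (cases "j \<le> t")
      case True then show ?thesis using mono[of j t] t by auto
    next
      case False then show ?thesis using mono[of "Suc t" j] t that by auto
    qed
    then show "x \<in> B - ?F" using t by auto
  qed
  also have "emeasure lborel \<dots> = (\<Sum>t<L. emeasure lborel (B \<inter> {X t<..<X (Suc t)}))"
  proof (rule sum_emeasure[symmetric])
    show "disjoint_family_on (\<lambda>t. B \<inter> {X t<..<X (Suc t)}) {..<L}"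
    proof (clarsimp simp: disjoint_family_on_def)
      fix i j assume ij: "i < L" "j < L" "i \<noteq> j"
      then have "X (Suc i) \<le> X j \<or> X (Suc j) \<le> X i"
        using mono[of "Suc i" j] mono[of "Suc j" i] by (cases "i < j") auto
      then show "B \<inter> {X i<..<X (Suc i)} \<inter> (B \<inter> {X j<..<X (Suc j)}) = {}" by auto
    qed
  qed (use B in auto)
  finally show ?thesis .
qed

lemma IVT_closed_segment:
  fixes f :: "real \<Rightarrow> real"
  assumes "a \<le> b" "continuous_on {a..b} f"
  shows "closed_segment (f a) (f b) \<subseteq> f ` {a..b}"
proof
  fix y assume y: "y \<in> closed_segment (f a) (f b)"
  show "y \<in> f ` {a..b}"
  proof (cases "f a \<le> f b")
    case True
    then show ?thesis using y IVT'[of f a y b] assms by (auto simp: closed_segment_eq_real_ivl)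
  next
    case False
    then show ?thesis using y IVT2'[of f b y a] assms by (auto simp: closed_segment_eq_real_ivl)
  qed
qed

subsection \<open>Maps crossing the cells of a uniform grid\<close>

text \<open>Step \<open>t\<close> runs affinely from height \<open>v t / n\<close> to the adjacent height \<open>v (Suc t) / n\<close> in time
  \<open>2\<^sup>-\<^sup>k / n\<close> with \<open>k = k t\<close>. The crossings of a cell spread their duration uniformly over it, so
  \<open>mass\<close> is exactly preservation of Lebesgue measure.\<close>

locale crossing_map =
  fixes m n L :: nat and v k :: "nat \<Rightarrow> nat"
  assumes n: "n = 2 ^ m"
    and v_le: "t \<le> L \<Longrightarrow> v t \<le> n"
    and v_step: "t < L \<Longrightarrow> v (Suc t) = Suc (v t) \<or> v t = Suc (v (Suc t))"
    and mass: "j < n \<Longrightarrow> (\<Sum>t | t < L \<and> min (v t) (v (Suc t)) = j. (1/2) ^ k t) = (1::real)"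
    and k_pos: "t < L \<Longrightarrow> 1 \<le> k t"
    and k_adj: "Suc t < L \<Longrightarrow> 2 \<le> k t \<or> 2 \<le> k (Suc t)"
begin

section \<open>The path and its affine pieces\<close>

definition cell :: "nat \<Rightarrow> nat" where
  "cell t = min (v t) (v (Suc t))"

definition X :: "nat \<Rightarrow> real" where
  "X t = (\<Sum>r<t. (1/2) ^ k r) / n"

definition slope :: "nat \<Rightarrow> real" where
  "slope t = (real (v (Suc t)) - real (v t)) * 2 ^ k t"

text \<open>The difference of minima is the part of step \<open>t\<close> elapsed at time
  \<open>x\<close>. A finite sum of such terms is continuous at once, with no pieces to
  glue.\<close>

definition f :: "real \<Rightarrow> real" where
  "f x = v 0 / n + (\<Sum>t<L. slope t * (min x (X (Suc t)) - min x (X t)))"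

definition g :: "real \<Rightarrow> real" where
  "g = restrict f {0..1}"

lemma n_pos: "0 < n" by (simp add: n)

lemma cell_less: "t < L \<Longrightarrow> cell t < n"
  using v_step[of t] v_le[of t] v_le[of "Suc t"] by (auto simp: cell_def)

text \<open>Steps are grouped by the cell they cross, where \<open>mass\<close> makes the weights
  add up to 1. With \<open>F\<close> constantly 1 the path lasts exactly unit time; with the
  measures of a set in the cells as \<open>F\<close> this becomes preservation of measure.\<close>

lemma sum_cells:
  "(\<Sum>t<L. F (cell t) * (1/2) ^ k t) = (\<Sum>j<n. F j :: real)"
proof -
  have "(\<Sum>t<L. F (cell t) * (1/2) ^ k t) =
      (\<Sum>j<n. \<Sum>t | t \<in> {..<L} \<and> cell t = j. F (cell t) * (1/2) ^ k t)"
    by (rule sum.group[symmetric]) (auto simp: cell_less)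
  also have "\<dots> = (\<Sum>j<n. F j)"
  proof (rule sum.cong)
    fix j assume "j \<in> {..<n}"
    then have "(\<Sum>t | t \<in> {..<L} \<and> cell t = j. F (cell t) * (1/2) ^ k t) = F j * 1"
      by (subst mass[of j, symmetric]) (auto simp: sum_distrib_left cell_def intro!: sum.cong)
    then show "(\<Sum>t | t \<in> {..<L} \<and> cell t = j. F (cell t) * (1/2) ^ k t) = F j" by simp
  qed simp
  finally show ?thesis .
qed

lemma X_0 [simp]: "X 0 = 0" by (simp add: X_def)

lemma X_Suc: "X (Suc t) = X t + (1/2) ^ k t / n"
  by (simp add: X_def add_divide_distrib)

lemma X_less_Suc [simp]: "X t < X (Suc t)"
  using n_pos by (simp add: X_Suc)

lemma strict_mono_X: "strict_mono X"
  by (simp add: strict_mono_Suc_iff)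

lemma X_L [simp]: "X L = 1"
  using sum_cells[of "\<lambda>_. 1"] n_pos by (simp add: X_def)

lemma L_pos: "0 < L"
  using X_L X_0 by (cases L) auto

lemma X_mono: "i \<le> j \<Longrightarrow> X i \<le> X j"
  using strict_mono_X by (simp add: strict_mono_less_eq)

lemma X_nonneg: "0 \<le> X t"
  using X_mono[of 0 t] by simp

lemma X_le_1: "t \<le> L \<Longrightarrow> X t \<le> 1"
  using X_mono[of t L] by simp

lemma slope_eq: "t < L \<Longrightarrow> slope t = 2 ^ k t \<or> slope t = - (2 ^ k t)"
  using v_step[of t] by (auto simp: slope_def)

lemma abs_slope: "t < L \<Longrightarrow> \<bar>slope t\<bar> = 2 ^ k t"
  using slope_eq[of t] by auto

lemma slope_nonzero: "t < L \<Longrightarrow> slope t \<noteq> 0"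
  using slope_eq[of t] by auto

lemma slope_X: "slope t * (X (Suc t) - X t) = (real (v (Suc t)) - real (v t)) / n"
  by (simp add: slope_def X_Suc power_one_over)

text \<open>Steps finished by time \<open>x\<close> contribute their full rise, so the heights
  telescope.\<close>

lemma partial_sum_f:
  "X t \<le> x \<Longrightarrow> v 0 / n + (\<Sum>r<t. slope r * (min x (X (Suc r)) - min x (X r))) = v t / n"
proof (induction t)
  case (Suc t)
  have "X t \<le> x" using Suc.prems X_less_Suc[of t] by linarith
  then show ?case using Suc slope_X[of t] by (simp add: min_absorb2 diff_divide_distrib)
qed simp

lemma f_piece:
  assumes "t < L" "X t \<le> x" "x \<le> X (Suc t)"
  shows "f x = v t / n + slope t * (x - X t)"
proof -
  let ?T = "\<lambda>r. slope r * (min x (X (Suc r)) - min x (X r))"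
  have "(\<Sum>r<L. ?T r) = (\<Sum>r<Suc t. ?T r) + (\<Sum>r=Suc t..<L. ?T r)"
    using sum.atLeastLessThan_concat[of 0 "Suc t" L ?T] assms(1) by (simp add: atLeast0LessThan)
  \<comment> \<open>Steps that start at \<open>x\<close> or later have both minima equal to
    \<open>x\<close>.\<close>
  also have "(\<Sum>r=Suc t..<L. ?T r) = 0"
  proof (rule sum.neutral, rule ballI)
    fix r assume "r \<in> {Suc t..<L}"
    then have "x \<le> X r" using X_mono[of "Suc t" r] assms by auto
    moreover from this have "x \<le> X (Suc r)" using X_less_Suc[of r] by linarith
    ultimately show "?T r = 0" by simp
  qed
  finally show ?thesis
    using partial_sum_f[OF assms(2)] assms by (simp add: f_def min_absorb2 min_absorb1)
qed

lemma f_X: "t \<le> L \<Longrightarrow> f (X t) = v t / n"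
proof (cases "t = L")
  case True
  then show ?thesis using partial_sum_f[of L "X L"] by (simp only: f_def)
next
  case False
  assume "t \<le> L"
  then show ?thesis using False f_piece[of t "X t"] X_less_Suc[of t] by simp
qed

lemma continuous_on_f: "continuous_on A f"
  unfolding f_def[abs_def] by (intro continuous_intros)

lemma obtain_piece:
  assumes "x \<in> {0..1}"
  obtains t where "t < L" "X t \<le> x" "x \<le> X (Suc t)"
proof (cases "x = 1")
  case True
  then show ?thesis using that[of "L - 1"] L_pos X_mono[of "L - 1" L] by simp
next
  case False
  then have "X 0 \<le> x" "x < X L" using assms by auto
  then obtain t where "t < L" "X t \<le> x" "x < X (Suc t)" by (rule obtain_subinterval)
  then show ?thesis using that by simp
qed

lemma closed_segment_v:
  "t < L \<Longrightarrow> closed_segment (v t / n) (v (Suc t) / n) = {cell t / n .. Suc (cell t) / n}"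
  using v_step[of t] n_pos
  by (auto simp: closed_segment_eq_real_ivl cell_def min_def divide_simps)

lemma f_image_piece: "t < L \<Longrightarrow> {cell t / n .. Suc (cell t) / n} \<subseteq> f ` {X t..X (Suc t)}"
  using IVT_closed_segment[of "X t" "X (Suc t)" f] f_X[of t] f_X[of "Suc t"] closed_segment_v[of t]
    continuous_on_f X_less_Suc[of t] by (simp add: less_imp_le)

lemma f_piece_in_cell:
  assumes "t < L" "X t \<le> x" "x \<le> X (Suc t)"
  shows "f x \<in> {cell t / n .. Suc (cell t) / n}"
proof -
  \<comment> \<open>\<open>u\<close> is the elapsed fraction of the step, so the height interpolates
    linearly between its two ends.\<close>
  define u where "u = (x - X t) * 2 ^ k t * n"
  have "x - X t \<le> (1/2) ^ k t / n" using assms X_Suc[of t] by linarith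
  then have "u \<le> (1/2) ^ k t / n * 2 ^ k t * n"
    unfolding u_def by (intro mult_right_mono) auto
  then have u: "0 \<le> u" "u \<le> 1" using assms n_pos by (auto simp: u_def power_one_over)
  have "f x = (v t + (real (v (Suc t)) - real (v t)) * u) / n"
    using f_piece[OF assms] n_pos by (simp add: u_def slope_def field_simps)
  then show ?thesis using v_step[OF assms(1)] u n_pos
    by (auto simp: cell_def divide_simps)
qed

lemma f_range: "x \<in> {0..1} \<Longrightarrow> f x \<in> {0..1}"
proof -
  assume "x \<in> {0..1}"
  then obtain t where t: "t < L" "X t \<le> x" "x \<le> X (Suc t)" by (rule obtain_piece)
  have "Suc (cell t) / n \<le> 1" using cell_less[OF t(1)] by simp
  moreover have "0 \<le> real (cell t) / n" by simp
  ultimately show ?thesis using f_piece_in_cell[OF t] by (metis atLeastAtMost_iff order_trans)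
qed

lemma obtain_crossing:
  assumes "j < n" obtains t where "t < L" "cell t = j"
proof -
  have "{t. t < L \<and> min (v t) (v (Suc t)) = j} \<noteq> {}"
    using mass[OF assms] by (metis sum.empty zero_neq_one)
  then show ?thesis using that by (auto simp: cell_def)
qed

lemma obtain_grid_cell:
  assumes "y \<in> {0..1}" obtains j where "j < n" "y \<in> {j / n .. Suc j / n}"
proof (cases "y = 1")
  case True
  then show ?thesis using that[of "n - 1"] n_pos by (auto simp: divide_simps)
next
  case False
  then have "real 0 / n \<le> y" "y < real n / n" using assms n_pos by auto
  then obtain j where "j < n" "real j / n \<le> y" "y < Suc j / n" by (rule obtain_subinterval)
  then show ?thesis using that by simp
qed

lemma f_onto: "f ` {0..1} = {0..1}"
proof
  show "{0..1} \<subseteq> f ` {0..1}"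
  proof
    fix y :: real assume "y \<in> {0..1}"
    then obtain j where j: "j < n" "y \<in> {j / n .. Suc j / n}" by (rule obtain_grid_cell)
    then obtain t where t: "t < L" "cell t = j" by (meson obtain_crossing)
    then have "y \<in> f ` {X t..X (Suc t)}" using f_image_piece[of t] j by auto
    then show "y \<in> f ` {0..1}" using X_nonneg[of t] X_le_1[of "Suc t"] t by auto
  qed
qed (use f_range in blast)

lemma g_eq [simp]: "x \<in> {0..1} \<Longrightarrow> g x = f x"
  by (simp add: g_def)

lemma g_image: "A \<subseteq> {0..1} \<Longrightarrow> g ` A = f ` A"
  by (auto simp: subset_iff)

section \<open>Preservation of Lebesgue measure\<close>

lemma emeasure_piece:
  assumes t: "t < L" and A: "A \<in> sets borel"
  shows "emeasure lborel (f -` A \<inter> {X t<..<X (Suc t)}) =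
    ennreal ((1/2) ^ k t) * emeasure lborel (A \<inter> {cell t / n <..< Suc (cell t) / n})"
    (is "?l = ennreal ((1/2) ^ k t) * emeasure lborel ?B")
proof -
  define c where "c = v t / n - slope t * X t"
  have "f -` A \<inter> {X t<..<X (Suc t)} = (\<lambda>x. c + slope t * x) -` ?B"
  proof -
    have fx: "f x = c + slope t * x" if "X t < x" "x < X (Suc t)" for x
      using f_piece[OF t, of x] that by (simp add: c_def algebra_simps)
    have "X t < x \<and> x < X (Suc t) \<longleftrightarrow>
        cell t / n < c + slope t * x \<and> c + slope t * x < Suc (cell t) / n" for x
    proof -
      define u where "u = (x - X t) * 2 ^ k t * n"
      have e: "c + slope t * x = (v t + (real (v (Suc t)) - real (v t)) * u) / n"
        using n_pos by (simp add: u_def c_def slope_def field_simps)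
      have "X t < x \<and> x < X (Suc t) \<longleftrightarrow> 0 < u \<and> u < 1"
        using n_pos by (auto simp: u_def X_Suc zero_less_mult_iff field_simps power_one_over)
      then show ?thesis using v_step[OF t] n_pos
        by (auto simp: e cell_def divide_simps)
    qed
    then show ?thesis
      by (intro set_eqI) (metis (no_types, lifting) Int_iff fx greaterThanLessThan_iff vimage_eq)
  qed
  then have "ennreal (2 ^ k t) * ?l = emeasure lborel ?B"
    using emeasure_lborel_affine_vimage[of "slope t" ?B c] A slope_nonzero[OF t] abs_slope[OF t] by simp
  then have "ennreal ((1/2) ^ k t) * emeasure lborel ?B = (ennreal ((1/2) ^ k t) * ennreal (2 ^ k t)) * ?l"
    by (simp add: mult.assoc)
  also have "ennreal ((1/2) ^ k t) * ennreal (2 ^ k t) = 1"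
    by (subst ennreal_mult[symmetric]) (auto simp: power_mult_distrib[symmetric])
  finally show ?thesis by simp
qed

text \<open>Each crossing of a cell pulls back the part of \<open>A\<close> in that cell at scale
  \<open>(1/2) ^ k t\<close>, and over all crossings of the cell these scales add up to 1.\<close>

lemma emeasure_f_vimage:
  assumes A: "A \<in> sets borel" "A \<subseteq> {0..1}"
  shows "emeasure lborel (f -` A \<inter> {0..1}) = emeasure lborel A"
proof -
  have [measurable]: "f \<in> borel_measurable borel"
    using continuous_on_f by (rule borel_measurable_continuous_onI)
  have B: "f -` A \<inter> {0..1} \<in> sets borel"
    using A(1) measurable_sets_borel[of f borel A] by auto
  let ?e = "\<lambda>j. emeasure lborel (A \<inter> {real j / n <..< Suc j / n})"
  have fin: "?e j < \<infinity>" for j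
    by (rule le_less_trans[OF emeasure_mono[of _ "{real j / n <..< Suc j / n}"]])
      (auto simp: divide_right_mono)
  have "emeasure lborel (f -` A \<inter> {0..1})
      = (\<Sum>t<L. emeasure lborel (f -` A \<inter> {0..1} \<inter> {X t<..<X (Suc t)}))"
    by (rule emeasure_lborel_subdivision) (use B in auto)
  also have "\<dots> = (\<Sum>t<L. ennreal ((1/2) ^ k t) * ?e (cell t))"
  proof (rule sum.cong)
    fix t assume "t \<in> {..<L}"
    then have "t < L" by simp
    moreover from this have "f -` A \<inter> {0..1} \<inter> {X t<..<X (Suc t)} = f -` A \<inter> {X t<..<X (Suc t)}"
      using X_nonneg[of t] X_le_1[of "Suc t"] by auto
    ultimately show "emeasure lborel (f -` A \<inter> {0..1} \<inter> {X t<..<X (Suc t)})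
        = ennreal ((1/2) ^ k t) * ?e (cell t)"
      using emeasure_piece[OF _ A(1), of t] by simp
  qed simp
  \<comment> \<open>\<open>sum_cells\<close> lives over the reals; the measures are finite, so
    passing through \<open>enn2real\<close> loses nothing.\<close>
  also have "\<dots> = (\<Sum>t<L. ennreal (enn2real (?e (cell t)) * (1/2) ^ k t))"
    using fin by (intro sum.cong) (auto simp: ennreal_mult mult.commute less_top)
  also have "\<dots> = ennreal (\<Sum>t<L. enn2real (?e (cell t)) * (1/2) ^ k t)"
    by (intro sum_ennreal) auto
  also have "\<dots> = (\<Sum>j<n. ennreal (enn2real (?e j)))"
    using sum_cells[of "\<lambda>j. enn2real (?e j)"] by (simp add: sum_ennreal)
  also have "\<dots> = (\<Sum>j<n. ?e j)"
    using fin by (intro sum.cong) (auto simp: less_top)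
  also have "\<dots> = emeasure lborel A"
    by (rule emeasure_lborel_subdivision[symmetric]) (use A n_pos in \<open>auto simp: divide_simps\<close>)
  finally show ?thesis .
qed

lemma lambda_preserving_g: "lambda_preserving g"
  unfolding lambda_preserving_def
proof (intro allI impI)
  fix A :: "real set" assume A: "A \<in> sets borel \<and> A \<subseteq> {0..1}"
  have eq: "g -` A \<inter> {0..1} = f -` A \<inter> {0..1}" by auto
  have m: "f -` A \<inter> {0..1} \<in> sets borel"
    using A measurable_sets_borel[OF borel_measurable_continuous_onI[OF continuous_on_f]] by auto
  show "emeasure (lebesgue_on {0..1}) A = emeasure (lebesgue_on {0..1}) (g -` A \<inter> {0..1})"
    unfolding eq using A m emeasure_f_vimage[of A] by (simp add: emeasure_restrict_space)
qed

lemma g_in_C_lambda: "g \<in> C_lambda"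
proof -
  have "continuous_on {0..1} g"
    using continuous_on_f[of "{0..1}"] by (rule continuous_on_eq) auto
  then show ?thesis
    using f_range lambda_preserving_g by (auto simp: C_lambda_def PiE_iff extensional_def g_def)
qed

section \<open>Derivatives and membership in the Thompson monoid\<close>

lemma has_derivative_linear_piece:
  "((\<lambda>x. v t / n + slope t * (x - X t)) has_vector_derivative slope t) (at x within S)"
  by (auto intro!: derivative_eq_intros simp: has_real_derivative_iff_has_vector_derivative[symmetric])

lemma piece_subset: "t < L \<Longrightarrow> {X t..X (Suc t)} \<subseteq> {0..1}"
  using X_nonneg[of t] X_le_1[of "Suc t"] by auto

lemma g_has_derivative:
  assumes "t < L" "X t < x" "x < X (Suc t)"
  shows "(g has_vector_derivative slope t) (at x within S)"
proof (rule has_vector_derivative_at_within,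
    rule has_vector_derivative_transform_within_open[OF has_derivative_linear_piece[where t = t]])
  show "open {X t<..<X (Suc t)}" "x \<in> {X t<..<X (Suc t)}" using assms by auto
  show "v t / n + slope t * (y - X t) = g y" if "y \<in> {X t<..<X (Suc t)}" for y
    using that f_piece[OF assms(1), of y] piece_subset[OF assms(1)] by auto
qed

lemma open_piece_diff_points: "t < L \<Longrightarrow> {X t<..<X (Suc t)} \<subseteq> diff_points g"
proof
  assume t: "t < L"
  fix x assume "x \<in> {X t<..<X (Suc t)}"
  then have "g differentiable (at x within {0..1})" "x \<in> {X t..X (Suc t)}"
    using differentiableI_vector[OF g_has_derivative[OF t]] by auto
  then show "x \<in> diff_points g" using piece_subset[OF t] by (auto simp: diff_points_def)
qed

text \<open>The derivative restricts to the closed piece, where a derivative is unique even at an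
  endpoint. Thus a node at which \<open>g\<close> is differentiable has the slope of every adjacent
  piece.\<close>

lemma der_piece:
  assumes t: "t < L" "X t \<le> x" "x \<le> X (Suc t)" and x: "x \<in> diff_points g"
  shows "der g x = slope t"
proof -
  have "(g has_vector_derivative der g x) (at x within {0..1})"
    using x by (simp add: diff_points_def der_def vector_derivative_works)
  then have "(g has_vector_derivative der g x) (at x within {X t..X (Suc t)})"
    using piece_subset[OF t(1)] by (rule has_vector_derivative_within_subset)
  moreover have "(g has_vector_derivative slope t) (at x within {X t..X (Suc t)})"
    by (rule has_vector_derivative_transform[OF _ _ has_derivative_linear_piece[where t = t]])
      (use t f_piece[OF t(1)] piece_subset[OF t(1)] in auto)
  ultimately show ?thesis
    using vector_derivative_unique_within_closed_interval[of "X t" "X (Suc t)" x g] t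
    by (simp add: cbox_interval)
qed

lemma not_diff_point: "{0..1} - diff_points g \<subseteq> X ` {..L}"
proof
  fix x assume x: "x \<in> {0..1} - diff_points g"
  then have "x \<in> {0..1}" by simp
  then obtain t where t: "t < L" "X t \<le> x" "x \<le> X (Suc t)" by (rule obtain_piece)
  then have "x = X t \<or> x = X (Suc t)" using open_piece_diff_points[OF t(1)] x by force
  then show "x \<in> X ` {..L}" using t by auto
qed

text \<open>At a differentiable node the two adjacent slopes agree, and elsewhere only one piece is
  involved. \<open>S\<close> is an open interval when slopes are shown to be constant, and all of
  \<open>diff_points g\<close> when breakpoints are located.\<close>

lemma der_locally_constant:
  assumes S: "S \<subseteq> diff_points g" and x: "x \<in> S" "0 < x" "x < 1"
  shows "eventually (\<lambda>y. der g x = der g y) (at x within S)"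
proof -
  have x': "X 0 \<le> x" "x < X L" using x by auto
  then obtain t where t: "t < L" "X t \<le> x" "x < X (Suc t)" by (rule obtain_subinterval)
  have dx: "der g x = slope t" by (rule der_piece) (use t x S in auto)
  obtain a where a: "a < x" "\<And>y. a < y \<Longrightarrow> y < X (Suc t) \<Longrightarrow> y \<in> S \<Longrightarrow> der g y = slope t"
  proof (cases "X t = x")
    case False
    then have lt: "X t < x" using t by auto
    have "der g y = slope t" if "X t < y" "y < X (Suc t)" "y \<in> S" for y
      by (rule der_piece) (use that t S in auto)
    then show ?thesis using that lt by blast
  next
    case True
    then obtain r where r: "t = Suc r" using x by (cases t) auto
    then have "der g x = slope r" using der_piece[of r x] True t x S X_less_Suc[of r] by auto
    then have eq: "slope r = slope t" using dx by simp
    show ?thesis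
    proof (rule that[of "X r"])
      show "X r < x" using True r by auto
      fix y assume y: "X r < y" "y < X (Suc t)" "y \<in> S"
      show "der g y = slope t"
      proof (cases "y \<le> X t")
        case True then show ?thesis using der_piece[of r y] y eq S t r by auto
      next
        case False then show ?thesis using der_piece[of t y] y S t by auto
      qed
    qed
  qed
  have "eventually (\<lambda>y. y \<in> {a<..<X (Suc t)} \<and> y \<in> S) (at x within S)"
    unfolding eventually_at_topological by (intro exI[of _ "{a<..<X (Suc t)}"]) (use a t in auto)
  then show ?thesis by eventually_elim (use a dx in auto)
qed

lemma der_constant:
  assumes "u < w" "{u<..<w} \<subseteq> diff_points g"
  shows "\<exists>j::int. (\<forall>x\<in>{u<..<w}. der g x = 2 powi j) \<or> (\<forall>x\<in>{u<..<w}. der g x = - (2 powi j))"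
proof -
  let ?z = "(u + w) / 2"
  have z: "?z \<in> {u<..<w}" using assms by auto
  have sub: "{u<..<w} \<subseteq> {0..1}" using assms(2) by (auto simp: diff_points_def)
  \<comment> \<open>Passing to the closure puts \<open>u\<close> and \<open>w\<close> in the unit
    interval, so the points between them avoid 0 and 1, as \<open>der_locally_constant\<close>
    requires.\<close>
  then have "closure {u<..<w} \<subseteq> {0..1}" by (rule closure_minimal) simp
  then have uw: "0 \<le> u" "w \<le> 1" using assms(1) by auto
  have const: "der g x = der g ?z" if "x \<in> {u<..<w}" for x
  proof (rule connected_local_const[of "{u<..<w}" x ?z "der g"])
    show "\<forall>a\<in>{u<..<w}. \<forall>\<^sub>F b in at a within {u<..<w}. der g a = der g b"
      using der_locally_constant[OF assms(2)] uw by auto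
  qed (use that z in simp_all)
  obtain t where t: "t < L" "X t \<le> ?z" "?z \<le> X (Suc t)" using z sub by (metis obtain_piece subsetD)
  then have "der g ?z = slope t" using der_piece z assms(2) by blast
  then show ?thesis using const slope_eq[OF t(1)] by (intro exI[of _ "int (k t)"]) auto
qed

lemma piecewise_affine_g: "piecewise_affine g"
  unfolding piecewise_affine_def
proof (intro exI[of _ "X ` {..L}"] conjI allI impI)
  fix u w :: real assume uw: "0 \<le> u \<and> u < w \<and> w \<le> 1 \<and> {u<..<w} \<inter> X ` {..L} = {}"
  then have u': "X 0 \<le> u" "u < X L" by auto
  then obtain t where t: "t < L" "X t \<le> u" "u < X (Suc t)" by (rule obtain_subinterval)
  have "X (Suc t) \<notin> {u<..<w}" using uw t by auto
  then have "w \<le> X (Suc t)" using t by auto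
  then have "\<forall>x\<in>{u<..<w}. g x = slope t * x + (v t / n - slope t * X t)"
    using f_piece[OF t(1)] t uw by (auto simp: algebra_simps)
  then show "\<exists>s b. \<forall>x\<in>{u<..<w}. g x = s * x + b" by blast
qed simp

text \<open>All slopes are at least \<open>1\<close> in absolute value, so the dyadic grid containing the nodes is
  mapped into itself; this is why the Markov property comes for free.\<close>

definition K :: nat where "K = (\<Sum>t<L. k t)"

definition grid :: "real set" where "grid = {x \<in> {0..1}. x * 2 ^ (m + K) \<in> \<int>}"

lemma real_n: "real n = 2 ^ m" by (simp add: n)

lemma k_le_K: "t < L \<Longrightarrow> k t \<le> K"
  unfolding K_def by (rule member_le_sum) auto

text \<open>Each duration \<open>(1/2) ^ k r / n\<close> is a multiple of the mesh because
  \<open>k r \<le> K\<close>.\<close>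

lemma X_in_grid: "t \<le> L \<Longrightarrow> X t \<in> grid"
proof -
  assume t: "t \<le> L"
  have "(1/2) ^ k r * 2 ^ K = (2::real) ^ (K - k r)" if "r < t" for r
    using k_le_K[of r] t that by (simp add: power_diff power_one_over)
  then have "(\<Sum>r<t. (1/2) ^ k r * 2 ^ K) = (\<Sum>r<t. (2::real) ^ (K - k r))"
    by (intro sum.cong) auto
  moreover have "X t * 2 ^ (m + K) = (\<Sum>r<t. (1/2) ^ k r * 2 ^ K)"
    by (simp add: X_def real_n power_add sum_distrib_right[symmetric])
  ultimately have "X t * 2 ^ (m + K) = (\<Sum>r<t. 2 ^ (K - k r))" by simp
  also have "\<dots> \<in> \<int>" by (intro Ints_sum Ints_power) auto
  finally have "X t * 2 ^ (m + K) \<in> \<int>" .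
  then show ?thesis using t X_nonneg X_le_1 by (simp add: grid_def)
qed

text \<open>The offset \<open>x - X t\<close> and the height \<open>v t / n\<close> are multiples of
  the mesh, and the slope is an integer.\<close>

lemma g_in_grid: "x \<in> grid \<Longrightarrow> g x \<in> grid"
proof -
  assume x: "x \<in> grid"
  then have x01: "x \<in> {0..1}" by (simp add: grid_def)
  then obtain t where t: "t < L" "X t \<le> x" "x \<le> X (Suc t)" by (rule obtain_piece)
  have slope: "slope t \<in> \<int>" by (simp add: slope_def)
  have "f x * 2 ^ m = v t + slope t * (x - X t) * 2 ^ m"
    by (simp add: f_piece[OF t] real_n distrib_right)
  then have "f x * 2 ^ m * 2 ^ K = (v t + slope t * (x - X t) * 2 ^ m) * 2 ^ K" by simp
  then have "g x * 2 ^ (m + K) = v t * 2 ^ K + slope t * (x * 2 ^ (m + K) - X t * 2 ^ (m + K))"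
    using x01 by (simp add: algebra_simps power_add)
  also have "\<dots> \<in> \<int>"
    using X_in_grid[of t] t x slope by (intro Ints_add Ints_mult[OF slope] Ints_diff) (auto simp: grid_def)
  finally show ?thesis using f_range[OF x01] x01 by (simp add: grid_def)
qed

lemma finite_grid: "finite grid"
proof -
  have "grid \<subseteq> (\<lambda>i. of_int i / 2 ^ (m + K)) ` {0..2 ^ (m + K)}"
  proof
    fix x assume x: "x \<in> grid"
    then obtain i where i: "x * 2 ^ (m + K) = of_int i" by (auto simp: grid_def elim: Ints_cases)
    have "0 \<le> x * 2 ^ (m + K)" "x * 2 ^ (m + K) \<le> 1 * 2 ^ (m + K)"
      using x by (auto simp: grid_def intro!: mult_right_mono)
    then have "0 \<le> i" "real_of_int i \<le> real_of_int (2 ^ (m + K))" using i by auto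
    then have "i \<in> {0..2 ^ (m + K)}" by (simp only: of_int_le_iff atLeastAtMost_iff)
    moreover have "x = of_int i / 2 ^ (m + K)" using i by (simp add: field_simps)
    ultimately show "x \<in> (\<lambda>i. of_int i / 2 ^ (m + K)) ` {0..2 ^ (m + K)}" by blast
  qed
  then show ?thesis by (rule finite_subset) simp
qed

lemma dyadic_grid: "x \<in> grid \<Longrightarrow> dyadic x"
proof -
  assume "x \<in> grid"
  then obtain i where "x * 2 ^ (m + K) = of_int i" by (auto simp: grid_def elim: Ints_cases)
  then have "x = of_int i / 2 ^ (m + K)" by (simp add: field_simps)
  then show ?thesis unfolding dyadic_def by blast
qed

lemma thompson_monoid_g: "g \<in> thompson_monoid"
  unfolding thompson_monoid_def
  using g_in_C_lambda g_image[of "{0..1}"] f_onto piecewise_affine_g der_constant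
    finite_subset[OF not_diff_point] not_diff_point X_in_grid dyadic_grid
  by auto

lemma breakpoint_subset: "breakpoint g x \<Longrightarrow> x \<in> X ` {..L}"
proof (rule ccontr)
  assume b: "breakpoint g x" and x: "x \<notin> X ` {..L}"
  \<comment> \<open>The points 0 and 1 are breakpoints by definition; they are the first and the
    last node.\<close>
  have "X 0 \<in> X ` {..L}" "X L \<in> X ` {..L}" by blast+
  then have "x \<noteq> 0" "x \<noteq> 1" using x by auto
  then have x01: "x \<in> {0..1}" "0 < x" "x < 1" using b by (auto simp: breakpoint_def)
  have d: "x \<in> diff_points g" using not_diff_point x x01 by blast
  have "continuous (at x within diff_points g) (der g)"
    unfolding continuous_within
    by (rule tendsto_eventually)
       (use der_locally_constant[OF order.refl d] x01 in \<open>auto elim: eventually_mono\<close>)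
  then show False using b d x01 by (auto simp: breakpoint_def)
qed

lemma markov_g: "markov g"
  unfolding markov_def
proof (intro conjI allI impI piecewise_affine_g)
  fix x assume "breakpoint g x"
  then have "x \<in> grid" using breakpoint_subset X_in_grid by blast
  then have "(g ^^ i) x \<in> grid" for i by (induction i) (auto intro: g_in_grid)
  then have "finite (range (\<lambda>i. (g ^^ i) x))" by (intro finite_subset[OF _ finite_grid]) auto
  then have "\<not> inj (\<lambda>i. (g ^^ i) x)" using finite_imageD infinite_UNIV_nat by blast
  then obtain i j where "(g ^^ i) x = (g ^^ j) x" "i \<noteq> j" by (auto simp: inj_def)
  then show "\<exists>i j. j < i \<and> (g ^^ i) x = (g ^^ j) x" by (metis nat_neq_iff)
qed

lemma entropy_g: "entropy_lambda g = (\<Sum>t<L. k t * (1/2) ^ k t) / n"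
proof -
  let ?\<phi> = "\<lambda>x. log 2 \<bar>der g x\<bar>"
  let ?Y = "X ` {..L}"
  let ?M = "lebesgue_on {0..1::real}"
  have der: "?\<phi> x = k t" if "t < L" "X t < x" "x < X (Suc t)" for t x
    using der_piece[of t x] open_piece_diff_points[of t] that abs_slope[of t] by auto
  \<comment> \<open>The node terms carry whatever value \<open>der\<close> has there, so the
    integrand is exactly a simple function on the unit interval; those terms integrate to 0.\<close>
  have eq: "?\<phi> x = (\<Sum>t<L. real (k t) * indicator {X t<..<X (Suc t)} x) + (\<Sum>y\<in>?Y. ?\<phi> y * indicator {y} x)"
    if x: "x \<in> {0..1}" for x
  proof (cases "x \<in> ?Y")
    case True
    have "indicator {X t<..<X (Suc t)} x = (0::real)" for t
      using True strict_mono_X by (auto simp: indicator_def strict_mono_less)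
    then have "(\<Sum>t<L. real (k t) * indicator {X t<..<X (Suc t)} x) = 0" by (intro sum.neutral) simp
    moreover have "(\<Sum>y\<in>?Y. ?\<phi> y * indicator {y} x) = (\<Sum>y\<in>?Y. if y = x then ?\<phi> y else 0)"
      by (intro sum.cong) (auto simp: indicator_def)
    ultimately show ?thesis using True by (simp only: sum.delta finite_imageI finite_atMost if_True)
  next
    case False
    obtain t where t: "t < L" "X t \<le> x" "x \<le> X (Suc t)" using x by (rule obtain_piece)
    moreover have "x \<noteq> X t" "x \<noteq> X (Suc t)" using False t by force+
    ultimately have t': "X t < x" "x < X (Suc t)" by auto
    have "(\<Sum>r<L. real (k r) * indicator {X r<..<X (Suc r)} x) = (\<Sum>r<L. if r = t then real (k t) else 0)"
    proof (rule sum.cong)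
      fix r assume "r \<in> {..<L}"
      have "r = t" if "X r < x" "x < X (Suc r)"
      proof -
        have "X r < X (Suc t)" "X t < X (Suc r)" using that t' by auto
        then show ?thesis using strict_mono_X by (auto simp: strict_mono_less)
      qed
      then show "real (k r) * indicator {X r<..<X (Suc r)} x = (if r = t then real (k t) else 0)"
        using t' unfolding indicator_def by (cases "x \<in> {X r<..<X (Suc r)}") auto
    qed simp
    moreover have "(\<Sum>y\<in>?Y. ?\<phi> y * indicator {y} x) = 0"
      using False by (intro sum.neutral) (auto simp: indicator_def)
    ultimately show ?thesis using der[OF t(1) t'] t(1) by simp
  qed
  have sets: "A \<in> sets ?M" if "A \<in> sets borel" "A \<subseteq> {0..1}" for A
    using that by (simp add: sets_restrict_space_iff)
  have meas: "measure ?M A = measure lborel A" if "A \<in> sets borel" "A \<subseteq> {0..1}" for A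
    using that by (simp add: measure_restrict_space)
  have has_int: "has_bochner_integral ?M (\<lambda>x. c * indicator A x) (c * measure lborel A)"
    if "A \<in> sets borel" "A \<subseteq> {0..1}" for A and c :: real
  proof -
    have "emeasure ?M A \<le> emeasure ?M (space ?M)" by (rule emeasure_space)
    also have "\<dots> < \<infinity>" by (simp add: emeasure_restrict_space)
    finally have "has_bochner_integral ?M (indicator A) (measure ?M A)"
      using sets[OF that] by (intro has_bochner_integral_real_indicator)
    then show ?thesis using meas[OF that] by (intro has_bochner_integral_mult_right) auto
  qed
  have "has_bochner_integral ?M (\<lambda>x. (\<Sum>t<L. real (k t) * indicator {X t<..<X (Suc t)} x) + (\<Sum>y\<in>?Y. ?\<phi> y * indicator {y} x))
      ((\<Sum>t<L. k t * measure lborel {X t<..<X (Suc t)}) + (\<Sum>y\<in>?Y. ?\<phi> y * measure lborel {y}))"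
  proof (intro has_bochner_integral_add has_bochner_integral_sum has_int)
    show "{X t<..<X (Suc t)} \<subseteq> {0..1}" if "t \<in> {..<L}" for t
      using piece_subset[of t] that by auto
    show "{y} \<subseteq> {0..1}" if "y \<in> ?Y" for y
      using that X_nonneg X_le_1 by auto
  qed auto
  then have "has_bochner_integral ?M ?\<phi>
      ((\<Sum>t<L. k t * measure lborel {X t<..<X (Suc t)}) + (\<Sum>y\<in>?Y. ?\<phi> y * measure lborel {y}))"
    by (subst has_bochner_integral_cong[OF refl _ refl]) (use eq in auto)
  then have "entropy_lambda g = (\<Sum>t<L. k t * (X (Suc t) - X t))"
    unfolding entropy_lambda_def by (simp add: has_bochner_integral_integral_eq less_imp_le)
  then show ?thesis by (simp add: X_Suc sum_divide_distrib)
qed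

section \<open>Expansion and the locally eventually onto property\<close>

lemma expand_in_piece:
  assumes "t < L" "X t \<le> a" "a \<le> b" "b \<le> X (Suc t)"
  obtains a' b' where "{a'..b'} \<subseteq> f ` {a..b}" "b' - a' = 2 ^ k t * (b - a)"
proof -
  have "f b - f a = slope t * (b - a)"
    using f_piece[OF assms(1), of a] f_piece[OF assms(1), of b] assms by (simp add: algebra_simps)
  then have "\<bar>f b - f a\<bar> = 2 ^ k t * (b - a)"
    using abs_slope[OF assms(1)] assms by (simp add: abs_mult)
  moreover have "closed_segment (f a) (f b) \<subseteq> f ` {a..b}"
    using assms by (intro IVT_closed_segment continuous_on_f)
  ultimately show ?thesis using that[of "min (f a) (f b)" "max (f a) (f b)"]
    by (auto simp: closed_segment_eq_real_ivl min_def max_def split: if_splits)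
qed

text \<open>An interval containing no full piece meets at most two pieces, and by \<open>k_adj\<close> one of them
  has slope at least \<open>4\<close>; the worst split of the length is then \<open>2 : 1\<close>.\<close>

lemma expand:
  assumes ab: "0 \<le> a" "a < b" "b \<le> 1" and no: "\<And>t. t < L \<Longrightarrow> \<not> {X t..X (Suc t)} \<subseteq> {a..b}"
  obtains a' b' where "{a'..b'} \<subseteq> f ` {a..b}" "4/3 * (b - a) \<le> b' - a'"
proof -
  have a': "X 0 \<le> a" "a < X L" using ab by auto
  then obtain t where t: "t < L" "X t \<le> a" "a < X (Suc t)" by (rule obtain_subinterval)
  have two: "2 \<le> (2::real) ^ k r" if "r < L" for r
    using power_increasing[of 1 "k r" "2::real"] k_pos[OF that] by simp
  have four: "4 \<le> (2::real) ^ k r" if "2 \<le> k r" for r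
    using power_increasing[of 2 "k r" "2::real"] that by simp
  show ?thesis
  proof (cases "b \<le> X (Suc t)")
    case True
    then obtain a' b' where "{a'..b'} \<subseteq> f ` {a..b}" "b' - a' = 2 ^ k t * (b - a)"
      using expand_in_piece[OF t(1,2), of b] ab by auto
    then show ?thesis using that mult_right_mono[OF two[OF t(1)], of "b - a"] ab by force
  next
    case False
    have t2: "Suc t < L" using False ab t(1) by (metis Suc_lessI X_L)
    \<comment> \<open>Otherwise the whole piece \<open>Suc t\<close> would lie in
      \<open>{a..b}\<close>.\<close>
    have b: "b \<le> X (Suc (Suc t))"
      using no[OF t2] False t by (auto simp: subset_iff)
    obtain a1 b1 where 1: "{a1..b1} \<subseteq> f ` {a..X (Suc t)}" "b1 - a1 = 2 ^ k t * (X (Suc t) - a)"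
      using expand_in_piece[OF t(1,2), of "X (Suc t)"] t by auto
    obtain a2 b2 where 2: "{a2..b2} \<subseteq> f ` {X (Suc t)..b}" "b2 - a2 = 2 ^ k (Suc t) * (b - X (Suc t))"
      using expand_in_piece[OF t2, of "X (Suc t)" b] b False by auto
    have sub: "{a1..b1} \<subseteq> f ` {a..b}" "{a2..b2} \<subseteq> f ` {a..b}"
      using 1(1) 2(1) False t by (auto intro!: order_trans[OF _ image_mono])
    have len1: "c * (X (Suc t) - a) \<le> b1 - a1" if "c \<le> 2 ^ k t" for c
      unfolding 1(2) using that t by (intro mult_right_mono) auto
    have len2: "c * (b - X (Suc t)) \<le> b2 - a2" if "c \<le> 2 ^ k (Suc t)" for c
      unfolding 2(2) using that False by (intro mult_right_mono) auto
    \<comment> \<open>If both images were shorter, the part with slope at least 4 would be less than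
      a third of the interval and the other part less than two thirds.\<close>
    have "4/3 * (b - a) \<le> b1 - a1 \<or> 4/3 * (b - a) \<le> b2 - a2"
      using k_adj[OF t2]
    proof
      assume "2 \<le> k t"
      then show ?thesis using len1[OF four] len2[OF two[OF t2]] by argo
    next
      assume "2 \<le> k (Suc t)"
      then show ?thesis using len1[OF two[OF t(1)]] len2[OF four] by argo
    qed
    then show ?thesis using that sub by blast
  qed
qed

lemma g_funpow_subset: "A \<subseteq> {0..1} \<Longrightarrow> (g ^^ i) ` A \<subseteq> {0..1}"
proof (induction i)
  case (Suc i)
  then have sub: "(g ^^ i) ` A \<subseteq> {0..1}" by simp
  have "(g ^^ Suc i) ` A = g ` ((g ^^ i) ` A)" by (simp add: image_comp)
  also have "\<dots> = f ` ((g ^^ i) ` A)" by (rule g_image[OF sub])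
  also have "\<dots> \<subseteq> f ` {0..1}" using sub by (rule image_mono)
  finally show ?case using f_onto by simp
qed simp

text \<open>If no iterate contained a piece, \<open>expand\<close> could be applied forever, and
  intervals of length at least \<open>(4/3) ^ i * (b - a)\<close> would fit into the unit
  interval.\<close>

lemma eventually_covers_piece:
  assumes ab: "0 \<le> a" "a < b" "b \<le> 1"
  shows "\<exists>N t. t < L \<and> {X t..X (Suc t)} \<subseteq> (g ^^ N) ` {a..b}"
proof (rule ccontr)
  assume no: "\<not> ?thesis"
  have ab': "{a..b} \<subseteq> {0..1}" using ab by auto
  have grow: "\<exists>a' b'. {a'..b'} \<subseteq> (g ^^ i) ` {a..b} \<and> (4/3) ^ i * (b - a) \<le> b' - a'" for i
  proof (induction i)
    case (Suc i)
    then obtain a' b' where 1: "{a'..b'} \<subseteq> (g ^^ i) ` {a..b}" "(4/3) ^ i * (b - a) \<le> b' - a'" by blast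
    have "0 < (4/3) ^ i * (b - a)" using ab by simp
    then have lt: "a' < b'" using 1 by linarith
    have sub: "{a'..b'} \<subseteq> {0..1}" using 1(1) g_funpow_subset[OF ab'] by blast
    then have "0 \<le> a'" "b' \<le> 1" using lt by auto
    moreover have "\<not> {X t..X (Suc t)} \<subseteq> {a'..b'}" if "t < L" for t using no that 1(1) by blast
    ultimately obtain a2 b2 where 2: "{a2..b2} \<subseteq> f ` {a'..b'}" "4/3 * (b' - a') \<le> b2 - a2"
      using expand[OF _ lt] by blast
    have "{a2..b2} \<subseteq> g ` {a'..b'}" using 2(1) g_image[OF sub] by simp
    also have "\<dots> \<subseteq> g ` ((g ^^ i) ` {a..b})" using 1(1) by blast
    finally have "{a2..b2} \<subseteq> (g ^^ Suc i) ` {a..b}" by (simp add: image_comp)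
    moreover have "(4/3) ^ Suc i * (b - a) \<le> b2 - a2" using 1(2) 2(2) by simp
    ultimately show ?case by blast
  qed (use ab in auto)
  obtain i where "1 / (b - a) < (4/3::real) ^ i" using real_arch_pow[of "4/3" "1 / (b - a)"] by auto
  then have big: "1 < (4/3) ^ i * (b - a)" using ab by (simp add: field_simps)
  obtain a' b' where 1: "{a'..b'} \<subseteq> (g ^^ i) ` {a..b}" "(4/3) ^ i * (b - a) \<le> b' - a'"
    using grow by blast
  have "{a'..b'} \<subseteq> {0..1}" using 1(1) g_funpow_subset[OF ab'] by blast
  then show False using big 1(2) by auto
qed

end

text \<open>Unless enlarging \<open>T\<close> by neighbours adds a cell, \<open>T\<close> is closed
  under neighbours; walking up and down from one of its cells then reaches every cell.\<close>

lemma card_neighbourhood: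
  assumes T: "T \<subseteq> {..<n::nat}" "T \<noteq> {}"
  shows "min n (Suc (card T)) \<le> card {c. c < n \<and> (\<exists>j\<in>T. c \<le> Suc j \<and> j \<le> Suc c)}"
    (is "_ \<le> card ?N")
proof -
  have TN: "T \<subseteq> ?N"
  proof
    fix j assume "j \<in> T"
    then show "j \<in> ?N" using T by (auto intro!: bexI[of _ j])
  qed
  show ?thesis
  proof (cases "?N \<subseteq> T")
    case False
    have "T \<subset> ?N" using False TN by blast
    then have "card T < card ?N" by (intro psubset_card_mono) auto
    then show ?thesis by simp
  next
    case True
    obtain j where j: "j \<in> T" using T by blast
    have up: "j + i < n \<Longrightarrow> j + i \<in> T" for i
    proof (induction i)
      case (Suc i)
      then have "j + i \<in> T" "j + Suc i < n" by auto
      then have "j + Suc i \<in> ?N" by auto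
      then show ?case using True by blast
    qed (use j in simp)
    have down: "j - i \<in> T" for i
    proof (induction i)
      case (Suc i)
      then have "j - Suc i \<in> ?N" using T by (auto intro!: bexI[of _ "j - i"])
      then show ?case using True by blast
    qed (use j in auto)
    have "c \<in> T" if "c < n" for c
      using up[of "c - j"] down[of "j - c"] that by (cases "j \<le> c") auto
    then have "T = {..<n}" using T by auto
    moreover have "card T \<le> card ?N" using TN by (intro card_mono) auto
    ultimately show ?thesis by simp
  qed
qed

context crossing_map begin

text \<open>Once an iterate contains a cell, \<open>cross\<close> takes a set \<open>S\<close> of
  covered cells to its image under \<open>\<sigma>\<close> enlarged by all neighbours. By
  \<open>card_neighbourhood\<close> the number of covered cells grows with each iteration until it
  is \<open>n\<close>.\<close>

lemma locally_eventually_onto_g: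
  assumes \<sigma>: "bij_betw \<sigma> {..<n} {..<n}"
    and cross: "\<And>i c. i < n \<Longrightarrow> c < n \<Longrightarrow> c \<le> Suc (\<sigma> i) \<Longrightarrow> \<sigma> i \<le> Suc c \<Longrightarrow>
      \<exists>t<L. cell t = c \<and> {X t..X (Suc t)} \<subseteq> {i / n..Suc i / n}"
  shows "locally_eventually_onto g"
  unfolding locally_eventually_onto_def
proof (intro allI impI)
  fix U :: "real set"
  assume U: "openin (top_of_set {0..1}) U \<and> U \<noteq> {}"
  then have U01: "U \<subseteq> {0..1}" by (meson openin_imp_subset)
  obtain a b where ab: "0 \<le> a" "a < b" "b \<le> 1" "{a..b} \<subseteq> U"
  proof -
    obtain x where x: "x \<in> U" using U by blast
    then obtain e where e: "e > 0" "ball x e \<inter> {0..1} \<subseteq> U"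
      using U unfolding openin_contains_ball by blast
    have x01: "0 \<le> x" "x \<le> 1" using x U01 by auto
    \<comment> \<open>Since \<open>d \<le> 1 / 2\<close>, an interval of length \<open>d\<close>
      fits on at least one side of \<open>x\<close>.\<close>
    define d where "d = min (e / 2) (1 / 2)"
    have d: "0 < d" "d < e" "d \<le> 1 / 2" using e by (auto simp: d_def)
    show ?thesis
    proof (cases "x \<le> 1 / 2")
      case True
      have "{x..x + d} \<subseteq> U" using e d x01 True by (auto simp: subset_iff dist_real_def)
      then show ?thesis using that[of x "x + d"] d x01 True by simp
    next
      case False
      have "{x - d..x} \<subseteq> U" using e d x01 False by (auto simp: subset_iff dist_real_def)
      then show ?thesis using that[of "x - d" x] d x01 False by simp
    qed
  qed
  then obtain N t where t: "t < L" "{X t..X (Suc t)} \<subseteq> (g ^^ N) ` {a..b}"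
    using eventually_covers_piece by blast
  \<comment> \<open>One more iteration turns the covered piece into a covered cell.\<close>
  define V where "V = (g ^^ Suc N) ` U"
  have V01: "V \<subseteq> {0..1}" unfolding V_def by (rule g_funpow_subset[OF U01])
  have "{cell t / n .. Suc (cell t) / n} \<subseteq> f ` {X t..X (Suc t)}" by (rule f_image_piece[OF t(1)])
  also have "\<dots> = g ` {X t..X (Suc t)}" by (rule g_image[symmetric, OF piece_subset[OF t(1)]])
  also have "\<dots> \<subseteq> g ` ((g ^^ N) ` U)" using t(2) ab(4) by blast
  also have "\<dots> = V" by (simp add: V_def image_comp)
  finally have start: "{cell t / n .. Suc (cell t) / n} \<subseteq> V" .
  have grow: "\<exists>S\<subseteq>{..<n}. S \<noteq> {} \<and> min n (Suc i) \<le> card S \<and>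
      (\<forall>j\<in>S. {real j / n .. Suc j / n} \<subseteq> (g ^^ i) ` V)" for i
  proof (induction i)
    case 0
    show ?case using start cell_less[OF t(1)] by (intro exI[of _ "{cell t}"]) auto
  next
    case (Suc i)
    then obtain S where S: "S \<subseteq> {..<n}" "S \<noteq> {}" "min n (Suc i) \<le> card S"
      "\<And>j. j \<in> S \<Longrightarrow> {real j / n .. Suc j / n} \<subseteq> (g ^^ i) ` V" by blast
    let ?T = "\<sigma> ` S"
    let ?S' = "{c. c < n \<and> (\<exists>j\<in>?T. c \<le> Suc j \<and> j \<le> Suc c)}"
    have inj: "inj_on \<sigma> S" using \<sigma> S(1) by (auto simp: bij_betw_def intro: inj_on_subset)
    have T: "?T \<subseteq> {..<n}" using \<sigma> S(1) by (auto simp: bij_betw_def)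
    have card: "min n (Suc (card S)) \<le> card ?S'"
      using card_neighbourhood[OF T] S(2) card_image[OF inj] by simp
    have "{real c / n .. Suc c / n} \<subseteq> (g ^^ Suc i) ` V" if c: "c \<in> ?S'" for c
    proof -
      obtain j where j: "j \<in> S" "c \<le> Suc (\<sigma> j)" "\<sigma> j \<le> Suc c" using c by blast
      then obtain r where r: "r < L" "cell r = c" "{X r..X (Suc r)} \<subseteq> {j / n..Suc j / n}"
        using cross[of j c] c S(1) by auto
      have "{real c / n .. Suc c / n} \<subseteq> g ` {X r..X (Suc r)}"
        using f_image_piece[OF r(1)] r(2) g_image[OF piece_subset[OF r(1)]] by simp
      also have "\<dots> \<subseteq> g ` ((g ^^ i) ` V)" using r(3) S(4)[OF j(1)] by blast
      finally show ?thesis by (simp add: image_comp)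
    qed
    moreover have "min n (Suc (Suc i)) \<le> card ?S'" using card S(3) by simp
    moreover have "?S' \<noteq> {}" using S(2) T by fastforce
    ultimately show ?case by (intro exI[of _ ?S']) auto
  qed
  obtain S where S: "S \<subseteq> {..<n}" "min n (Suc n) \<le> card S"
      "\<And>j. j \<in> S \<Longrightarrow> {real j / n .. Suc j / n} \<subseteq> (g ^^ n) ` V" using grow[of n] by blast
  have "S = {..<n}" using S(1,2) by (intro card_seteq) auto
  have "{0..1} \<subseteq> (g ^^ n) ` V"
  proof
    fix y :: real assume "y \<in> {0..1}"
    then obtain j where "j < n" "y \<in> {j / n .. Suc j / n}" by (rule obtain_grid_cell)
    then show "y \<in> (g ^^ n) ` V" using S(3)[of j] \<open>S = {..<n}\<close> by auto
  qed
  then have "(g ^^ n) ` V = {0..1}" using g_funpow_subset[OF V01] by blast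
  then have "(g ^^ (n + Suc N)) ` U = {0..1}"    unfolding V_def funpow_add image_comp .
  then show "\<exists>N. (g ^^ N) ` U = {0..1}" by blast
qed

end

subsection \<open>Matchings and dyadic distributions\<close>

text \<open>Either all nonempty proper subsets have a spare neighbour, and a pair \<open>a\<close>,
  \<open>b\<close> can be matched and removed; or some such \<open>S\<close> is tight, and
  \<open>S\<close> and its complement are matched separately, the latter outside the neighbours of
  \<open>S\<close>.\<close>

lemma hall_marriage:
  assumes "finite A" "\<And>a. a \<in> A \<Longrightarrow> finite (N a)"
    and "\<And>S. S \<subseteq> A \<Longrightarrow> card S \<le> card (\<Union>a\<in>S. N a)"
  shows "\<exists>\<sigma>. inj_on \<sigma> A \<and> (\<forall>a\<in>A. \<sigma> a \<in> N a)"
  using assms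
proof (induction A arbitrary: N rule: finite_psubset_induct)
  case (psubset A)
  have fin: "finite (\<Union>a\<in>S. N a)" if "S \<subseteq> A" for S
    using that psubset.hyps psubset.prems(1) by (auto intro: finite_subset)
  have finS: "finite S" if "S \<subseteq> A" for S using that psubset.hyps by (rule finite_subset)
  consider "A = {}" | "A \<noteq> {}" "\<And>S. S \<subset> A \<Longrightarrow> S \<noteq> {} \<Longrightarrow> card S < card (\<Union>a\<in>S. N a)"
    | S where "S \<subset> A" "S \<noteq> {}" "card (\<Union>a\<in>S. N a) \<le> card S"
    by (meson not_le)
  then show ?case
  proof cases
    case 1
    then show ?thesis by simp
  next
    case 2
    then obtain a where a: "a \<in> A" by blast
    have "card {a} \<le> card (\<Union>x\<in>{a}. N x)" using psubset.prems(2)[of "{a}"] a by blast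
    then have "N a \<noteq> {}" by auto
    then obtain b where b: "b \<in> N a" by blast
    have "\<exists>\<sigma>. inj_on \<sigma> (A - {a}) \<and> (\<forall>x\<in>A - {a}. \<sigma> x \<in> N x - {b})"
    proof (rule psubset.IH)
      show "A - {a} \<subset> A" using a by blast
      show "finite (N x - {b})" if "x \<in> A - {a}" for x using that psubset.prems(1) by blast
      show "card S \<le> card (\<Union>x\<in>S. N x - {b})" if S: "S \<subseteq> A - {a}" for S
      proof (cases "S = {}")
        case False
        have "(\<Union>x\<in>S. N x - {b}) = (\<Union>x\<in>S. N x) - {b}" by blast
        moreover have "card S < card (\<Union>x\<in>S. N x)" using S a False by (intro 2) auto
        \<comment> \<open>Removing \<open>b\<close> costs at most one neighbour, which the strict
          inequality can spare.\<close>
        moreover have "card (\<Union>x\<in>S. N x) - 1 \<le> card ((\<Union>x\<in>S. N x) - {b})"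
          by (simp add: card_Diff_singleton_if)
        ultimately show ?thesis by simp
      qed simp
    qed
    then obtain \<sigma> where \<sigma>: "inj_on \<sigma> (A - {a})" "\<And>x. x \<in> A - {a} \<Longrightarrow> \<sigma> x \<in> N x - {b}" by blast
    have "inj_on (\<sigma>(a := b)) A" using \<sigma> by (fastforce simp: inj_on_def)
    moreover have "\<forall>x\<in>A. (\<sigma>(a := b)) x \<in> N x" using \<sigma>(2) b by auto
    ultimately show ?thesis by blast
  next
    case 3
    define U where "U = (\<Union>a\<in>S. N a)"
    have "\<exists>\<sigma>. inj_on \<sigma> S \<and> (\<forall>x\<in>S. \<sigma> x \<in> N x)"
      using 3 psubset.prems by (intro psubset.IH) auto
    then obtain \<sigma>1 where \<sigma>1: "inj_on \<sigma>1 S" "\<And>x. x \<in> S \<Longrightarrow> \<sigma>1 x \<in> N x" by blast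
    have "\<exists>\<sigma>. inj_on \<sigma> (A - S) \<and> (\<forall>x\<in>A - S. \<sigma> x \<in> N x - U)"
    proof (rule psubset.IH)
      show "A - S \<subset> A" using 3 by blast
      show "finite (N x - U)" if "x \<in> A - S" for x using that psubset.prems(1) by blast
      show "card T \<le> card (\<Union>x\<in>T. N x - U)" if T: "T \<subseteq> A - S" for T
      proof -
        have ST: "S \<union> T \<subseteq> A" using T 3 by blast
        \<comment> \<open>Hall's condition for \<open>S \<union> T\<close>, less the tight count for
          \<open>S\<close>, leaves the condition for \<open>T\<close>.\<close>
        have "card S + card T = card (S \<union> T)"
          using T 3(1) by (intro card_Un_disjoint[symmetric] finS) auto
        also have "\<dots> \<le> card (\<Union>x\<in>S \<union> T. N x)" by (rule psubset.prems(2)[OF ST])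
        also have "(\<Union>x\<in>S \<union> T. N x) = U \<union> (\<Union>x\<in>T. N x - U)" by (auto simp: U_def)
        also have "card \<dots> \<le> card U + card (\<Union>x\<in>T. N x - U)" by (rule card_Un_le)
        finally show ?thesis using 3(3) by (simp add: U_def)
      qed
    qed
    then obtain \<sigma>2 where \<sigma>2: "inj_on \<sigma>2 (A - S)" "\<And>x. x \<in> A - S \<Longrightarrow> \<sigma>2 x \<in> N x - U" by blast
    let ?\<sigma> = "\<lambda>x. if x \<in> S then \<sigma>1 x else \<sigma>2 x"
    have "inj_on ?\<sigma> A"
    proof (rule inj_onI)
      fix x y assume xy: "x \<in> A" "y \<in> A" "?\<sigma> x = ?\<sigma> y"
      have U1: "\<sigma>1 z \<in> U" if "z \<in> S" for z using \<sigma>1(2)[OF that] that by (auto simp: U_def)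
      have "x \<in> S \<longleftrightarrow> y \<in> S"
        using xy \<sigma>2(2)[of x] \<sigma>2(2)[of y] U1[of x] U1[of y] by (auto split: if_split_asm)
      then show "x = y" using xy \<sigma>1(1) \<sigma>2(1) by (auto simp: inj_on_def split: if_splits)
    qed
    moreover have "\<forall>x\<in>A. ?\<sigma> x \<in> N x" using \<sigma>1(2) \<sigma>2(2) by auto
    ultimately show ?thesis by blast
  qed
qed

text \<open>A new element takes weight 1/2 and the old weights are halved. The entropy passes from
  \<open>h\<close> to \<open>1 + h / 2\<close>, so the bound 2 persists for any number of
  elements.\<close>

lemma dyadic_distribution:
  assumes "finite T" "T \<noteq> {}"
  shows "\<exists>e::'a \<Rightarrow> nat. (\<Sum>t\<in>T. (1/2) ^ e t) = (1::real) \<and> (\<Sum>t\<in>T. e t * (1/2) ^ e t) \<le> (2::real)"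
  using assms
proof (induction T rule: finite_ne_induct)
  case (singleton x)
  show ?case by (intro exI[of _ "\<lambda>_. 0"]) simp
next
  case (insert x T)
  then obtain e :: "'a \<Rightarrow> nat" where
    e: "(\<Sum>t\<in>T. (1/2) ^ e t) = (1::real)" "(\<Sum>t\<in>T. e t * (1/2) ^ e t) \<le> (2::real)" by blast
  let ?e = "\<lambda>t. if t = x then 1 else Suc (e t)"
  have T: "t \<noteq> x" if "t \<in> T" for t using that insert by auto
  have "(\<Sum>t\<in>T. (1/2) ^ ?e t) = (\<Sum>t\<in>T. (1/2) ^ e t * (1/2::real))"
    by (intro sum.cong) (auto dest: T)
  also have "\<dots> = 1/2" using e(1) by (simp only: sum_distrib_right[symmetric])
  finally have 1: "(\<Sum>t\<in>T. (1/2) ^ ?e t) = (1/2::real)" .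
  have "(\<Sum>t\<in>T. ?e t * (1/2) ^ ?e t) = (\<Sum>t\<in>T. ((1/2) ^ e t + e t * (1/2) ^ e t) * (1/2::real))"
    by (intro sum.cong) (auto dest: T simp: field_simps)
  also have "\<dots> \<le> 3/2" using e by (simp only: sum_distrib_right[symmetric] sum.distrib) simp
  finally have 2: "(\<Sum>t\<in>T. ?e t * (1/2) ^ ?e t) \<le> (3/2::real)" .
  show ?case
  proof (intro exI[of _ ?e] conjI)
    have s: "sum F (insert x T) = F x + sum F T" for F :: "'a \<Rightarrow> real"
      using insert(1,3) by simp
    show "(\<Sum>t\<in>insert x T. (1/2) ^ ?e t) = (1::real)" unfolding s 1 by simp
    show "(\<Sum>t\<in>insert x T. ?e t * (1/2) ^ ?e t) \<le> (2::real)" unfolding s using 2 by simp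
  qed
qed

subsection \<open>Lists of steps\<close>

text \<open>A step is a start height, an end height and a mark: \<open>Some k\<close> fixes the exponent \<open>k\<close> of the step,
  \<open>None\<close> leaves it to be chosen later, among the very short ones.\<close>

type_synonym step = "nat \<times> nat \<times> nat option"

fun walk :: "nat \<Rightarrow> step list \<Rightarrow> nat \<Rightarrow> bool" where
  "walk a [] b \<longleftrightarrow> a = b"
| "walk a ((x, y, \<tau>) # s) b \<longleftrightarrow> x = a \<and> (y = Suc x \<or> x = Suc y) \<and> walk y s b"

lemma walk_append: "walk a s b \<Longrightarrow> walk b s' c \<Longrightarrow> walk a (s @ s') c"
  by (induction a s b rule: walk.induct) auto

text \<open>This lets the starting heights alone serve as the nodes of a crossing map, with
  \<open>b\<close> as the last one.\<close>

lemma walk_nth: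
  assumes "walk a s b" "t < length s"
  shows "(if Suc t < length s then fst (s ! Suc t) else b) = fst (snd (s ! t))"
    and "fst (snd (s ! t)) = Suc (fst (s ! t)) \<or> fst (s ! t) = Suc (fst (snd (s ! t)))"
proof -
  have hd: "s \<noteq> [] \<Longrightarrow> fst (hd s) = a" if "walk a s b" for a s b
    using that by (cases s) auto
  have "(if Suc t < length s then fst (s ! Suc t) else b) = fst (snd (s ! t)) \<and>
      (fst (snd (s ! t)) = Suc (fst (s ! t)) \<or> fst (s ! t) = Suc (fst (snd (s ! t))))"
    using assms
  proof (induction a s b arbitrary: t rule: walk.induct)
    case (2 a x y \<tau> s b)
    then have w: "walk y s b" by simp
    show ?case
    proof (cases t)
      case 0
      then show ?thesis using 2 hd[OF w] w by (cases s) auto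
    next
      case (Suc r)
      then show ?thesis using "2.IH"[OF w, of r] 2(3) by (simp split: if_split_asm)
    qed
  qed simp
  then show "(if Suc t < length s then fst (s ! Suc t) else b) = fst (snd (s ! t))"
    "fst (snd (s ! t)) = Suc (fst (s ! t)) \<or> fst (s ! t) = Suc (fst (snd (s ! t)))" by auto
qed

section \<open>Excursions, blocks and their marked steps\<close>

definition wander :: "nat \<Rightarrow> nat \<Rightarrow> step list" where
  "wander a b = (if a \<le> b then map (\<lambda>c. (c, Suc c, None)) [a..<b]
     else map (\<lambda>c. (Suc c, c, None)) (rev [b..<a]))"

lemma walk_wander: "walk a (wander a b) b"
proof -
  have up: "walk a (map (\<lambda>c. (c, Suc c, None)) [a..<a + i]) (a + i)" for a i
    by (induction i) (auto intro: walk_append)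
  have down: "walk (b + i) (map (\<lambda>c. (Suc c, c, None)) (rev [b..<b + i])) b" for b i
    by (induction i) auto
  show ?thesis
    using up[of a "b - a"] down[of b "a - b"] by (cases "a \<le> b") (simp_all add: wander_def)
qed

lemma set_wander:
  "x \<in> set (wander a b) \<Longrightarrow>
    snd (snd x) = None \<and> fst x \<in> {min a b..max a b} \<and> fst (snd x) \<in> {min a b..max a b}"
  by (auto simp: wander_def min_def max_def split: if_split_asm)

lemma wander_crosses:
  "min a b \<le> c \<Longrightarrow> c < max a b \<Longrightarrow> \<exists>x\<in>set (wander a b). min (fst x) (fst (snd x)) = c"
  by (auto simp: wander_def)

lemma wander_nonempty: "a \<noteq> b \<Longrightarrow> wander a b \<noteq> []"
  by (auto simp: wander_def)

text \<open>The return from \<open>Suc j\<close> to \<open>j\<close> is a detour that crosses cell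
  \<open>j\<close> and its existing neighbours. The minimum and the truncated subtraction stop it at
  the ends of the grid.\<close>

definition excursion :: "nat \<Rightarrow> nat \<Rightarrow> step list" where
  "excursion n j = wander (Suc j) (min (j + 2) n) @ wander (min (j + 2) n) (j - 1) @ wander (j - 1) j"

text \<open>Each entry of \<open>ks\<close> gives one marked crossing of cell \<open>j\<close> and a
  return; then the path travels on to the start \<open>j'\<close> of the next block.\<close>

definition block :: "nat \<Rightarrow> nat list \<Rightarrow> nat \<Rightarrow> nat \<Rightarrow> step list" where
  "block n ks j j' = concat (map (\<lambda>k. (j, Suc j, Some k) # excursion n j) ks) @ wander j j'"

definition weight :: "(nat \<Rightarrow> nat \<Rightarrow> real) \<Rightarrow> step \<Rightarrow> real" where
  "weight F x = (case snd (snd x) of None \<Rightarrow> 0 | Some k \<Rightarrow> F (min (fst x) (fst (snd x))) k)"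

text \<open>With \<open>F\<close> left arbitrary, one computation yields elapsed time, mass and
  entropy of the marked steps.\<close>

definition total :: "(nat \<Rightarrow> nat \<Rightarrow> real) \<Rightarrow> step list \<Rightarrow> real" where
  "total F s = (\<Sum>x\<leftarrow>s. weight F x)"

lemma total_append [simp]: "total F (s @ s') = total F s + total F s'"
  and total_Nil [simp]: "total F [] = 0"
  and total_Cons [simp]: "total F (x # s) = weight F x + total F s"
  by (simp_all add: total_def)

lemma total_unmarked: "(\<And>x. x \<in> set s \<Longrightarrow> snd (snd x) = None) \<Longrightarrow> total F s = 0"
  by (induction s) (auto simp: weight_def)

lemma total_nonneg: "(\<And>c k. 0 \<le> F c k) \<Longrightarrow> 0 \<le> total F s"
  by (induction s) (auto simp: weight_def split: option.split)

lemma total_eq_sum: "total F s = (\<Sum>t<length s. weight F (s ! t))"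
  by (simp add: total_def sum_list_sum_nth atLeast0LessThan)

lemma walk_excursion: "walk (Suc j) (excursion n j) j"
  unfolding excursion_def by (rule walk_append[OF walk_wander walk_append[OF walk_wander walk_wander]])

lemma set_excursion:
  "j < n \<Longrightarrow> x \<in> set (excursion n j) \<Longrightarrow>
    snd (snd x) = None \<and> fst x \<in> {j - 1..min (j + 2) n} \<and> fst (snd x) \<in> {j - 1..min (j + 2) n}"
proof -
  assume j: "j < n" and "x \<in> set (excursion n j)"
  then consider "x \<in> set (wander (Suc j) (min (j + 2) n))" | "x \<in> set (wander (min (j + 2) n) (j - 1))"
    | "x \<in> set (wander (j - 1) j)" by (auto simp: excursion_def)
  then show ?thesis
  proof cases
    case 1
    then show ?thesis using set_wander[OF 1] j by (auto simp: min_def max_def split: if_split_asm)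
  next
    case 2
    then show ?thesis using set_wander[OF 2] j by (auto simp: min_def max_def split: if_split_asm)
  next
    case 3
    then show ?thesis using set_wander[OF 3] j by (auto simp: min_def max_def split: if_split_asm)
  qed
qed

lemma excursion_nonempty: "j < n \<Longrightarrow> excursion n j \<noteq> []"
  unfolding excursion_def by (simp add: wander_nonempty)

lemma excursion_crosses:
  assumes "j < n" "c < n" "c \<le> Suc j" "j \<le> Suc c"
  shows "\<exists>x\<in>set (excursion n j). min (fst x) (fst (snd x)) = c"
proof -
  have "\<exists>x\<in>set (wander (min (j + 2) n) (j - 1)). min (fst x) (fst (snd x)) = c"
    by (rule wander_crosses) (use assms in auto)
  then show ?thesis by (auto simp: excursion_def)
qed

lemma total_wander [simp]: "total F (wander a b) = 0"
  by (rule total_unmarked) (auto dest: set_wander)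

lemma total_excursion [simp]: "total F (excursion n j) = 0"
  by (simp add: excursion_def)

lemma walk_block: "walk j (block n ks j j') j'"
proof -
  have "walk j (concat (map (\<lambda>k. (j, Suc j, Some k) # excursion n j) ks)) j"
    by (induction ks) (auto intro: walk_append walk_excursion)
  then show ?thesis unfolding block_def by (rule walk_append[OF _ walk_wander])
qed

lemma total_block: "total F (block n ks j j') = (\<Sum>k\<leftarrow>ks. F j k)"
proof -
  have "total F (concat (map (\<lambda>k. (j, Suc j, Some k) # excursion n j) ks)) = (\<Sum>k\<leftarrow>ks. F j k)"
    by (induction ks) (auto simp: weight_def)
  then show ?thesis by (simp add: block_def)
qed

lemma set_block:
  assumes "j < n" "x \<in> set (block n ks j j')"
  shows "fst x \<in> {j - 1..min (j + 2) n} \<union> {min j j'..max j j'}"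
    "fst (snd x) \<in> {j - 1..min (j + 2) n} \<union> {min j j'..max j j'}"
    "snd (snd x) = None \<or> (\<exists>k\<in>set ks. snd (snd x) = Some k)"
proof -
  consider k where "k \<in> set ks" "x = (j, Suc j, Some k)" | "x \<in> set (excursion n j)"
    | "x \<in> set (wander j j')" using assms(2) by (auto simp: block_def)
  then have "fst x \<in> {j - 1..min (j + 2) n} \<union> {min j j'..max j j'} \<and>
    fst (snd x) \<in> {j - 1..min (j + 2) n} \<union> {min j j'..max j j'} \<and>
    (snd (snd x) = None \<or> (\<exists>k\<in>set ks. snd (snd x) = Some k))"
  proof cases
    case 1
    then show ?thesis using assms(1) by auto
  next
    case 2
    then show ?thesis using set_excursion[OF assms(1) 2] by blast
  next
    case 3
    then show ?thesis using set_wander[OF 3] by blast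
  qed
  then show "fst x \<in> {j - 1..min (j + 2) n} \<union> {min j j'..max j j'}"
    "fst (snd x) \<in> {j - 1..min (j + 2) n} \<union> {min j j'..max j j'}"
    "snd (snd x) = None \<or> (\<exists>k\<in>set ks. snd (snd x) = Some k)" by blast+
qed

text \<open>This provides \<open>k_adj\<close>, since unmarked steps receive large exponents. The
  condition on the last step makes the property stable under concatenation.\<close>

definition unmarked_gaps :: "step list \<Rightarrow> bool" where
  "unmarked_gaps s \<longleftrightarrow>
     successively (\<lambda>x y. snd (snd x) = None \<or> snd (snd y) = None) s \<and>
     (s \<noteq> [] \<longrightarrow> snd (snd (last s)) = None)"

lemma unmarked_gaps_append: "unmarked_gaps s \<Longrightarrow> unmarked_gaps s' \<Longrightarrow> unmarked_gaps (s @ s')"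
  by (cases "s' = []") (auto simp: unmarked_gaps_def successively_append_iff)

lemma unmarked_gaps_concat: "(\<And>s. s \<in> set ss \<Longrightarrow> unmarked_gaps s) \<Longrightarrow> unmarked_gaps (concat ss)"
proof (induction ss)
  case (Cons s ss)
  then show ?case by (simp add: unmarked_gaps_append)
qed (simp add: unmarked_gaps_def)

lemma unmarked_gaps_unmarked:
  assumes "\<And>y. y \<in> set s \<Longrightarrow> snd (snd y) = None"
  shows "unmarked_gaps s" "s \<noteq> [] \<Longrightarrow> unmarked_gaps (x # s)"
proof -
  let ?P = "\<lambda>x y :: step. snd (snd x) = None \<or> snd (snd y) = None"
  have *: "successively ?P (x # s)" for x
    using assms
  proof (induction s arbitrary: x)
    case (Cons y s)
    have "successively ?P (y # s)" using Cons by simp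
    moreover have "snd (snd y) = None" using Cons.prems[of y] by simp
    ultimately show ?case by simp
  qed simp
  have "successively ?P s" using *[of undefined] unfolding successively_Cons by auto
  moreover have "s \<noteq> [] \<Longrightarrow> snd (snd (last s)) = None" using assms last_in_set by blast
  ultimately show "unmarked_gaps s" "s \<noteq> [] \<Longrightarrow> unmarked_gaps (x # s)"
    using * unfolding unmarked_gaps_def by auto
qed

lemma unmarked_gaps_block: "j < n \<Longrightarrow> unmarked_gaps (block n ks j j')"
proof -
  assume j: "j < n"
  have "unmarked_gaps ((j, Suc j, Some k) # excursion n j)" for k
    by (rule unmarked_gaps_unmarked(2)) (use set_excursion[OF j] excursion_nonempty[OF j] in auto)
  moreover have "unmarked_gaps (wander j j')"
    by (rule unmarked_gaps_unmarked(1)) (use set_wander in blast)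
  ultimately show ?thesis
    unfolding block_def by (intro unmarked_gaps_append unmarked_gaps_concat) auto
qed

lemma unmarked_gaps_nth:
  "unmarked_gaps s \<Longrightarrow> Suc t < length s \<Longrightarrow> snd (snd (s ! t)) = None \<or> snd (snd (s ! Suc t)) = None"
  by (auto simp: unmarked_gaps_def successively_conv_nth)

text \<open>An entry is located together with everything before it, because the prefix determines
  when the step takes place.\<close>

lemma concat_blocks_split:
  assumes "concat (map B [0..<n]) = p @ x # q"
  shows "\<exists>i<n. \<exists>p' q'. B i = p' @ x # q' \<and> p = concat (map B [0..<i]) @ p'"
  using assms
proof (induction n arbitrary: q)
  case (Suc n)
  then have eq: "concat (map B [0..<n]) @ B n = p @ x # q" by simp
  then consider us where "concat (map B [0..<n]) = p @ us" "us @ B n = x # q"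
    | us where "concat (map B [0..<n]) @ us = p" "B n = us @ x # q"
    by (auto simp: append_eq_append_conv2)
  then show ?case
  proof cases
    case 1
    show ?thesis
    proof (cases us)
      case Nil
      then show ?thesis using 1 by (intro exI[of _ n]) auto
    next
      case (Cons y us')
      then have "concat (map B [0..<n]) = p @ x # us'" using 1 by simp
      then show ?thesis using Suc.IH less_Suc_eq by blast
    qed
  next
    case 2
    then show ?thesis by (intro exI[of _ n]) auto
  qed
qed simp

subsection \<open>The itinerary following a permutation of the cells\<close>

text \<open>The marked steps of a cell have exponents \<open>ks\<close>; the leftover mass
  \<open>(1/2) ^ B\<close> is shared by its unmarked steps. The entry \<open>hd ks = 1\<close> puts
  the first excursion of a block near the middle of its time cell, and the bound on \<open>B\<close>
  keeps the drift caused by unmarked steps within half a cell.\<close>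

locale itinerary =
  fixes m n B :: nat and ks :: "nat list" and \<sigma> :: "nat \<Rightarrow> nat"
  assumes n_eq: "n = 2 ^ m"
    and \<sigma>: "bij_betw \<sigma> {..<n} {..<n}"
    and ks: "ks \<noteq> []" "hd ks = 1" "\<And>k. k \<in> set ks \<Longrightarrow> 1 \<le> k"
    and sum_ks: "(\<Sum>k\<leftarrow>ks. (1/2) ^ k) = 1 - (1/2 :: real) ^ B"
    and B: "2 \<le> B" "(1/2 :: real) ^ B \<le> 1 / (2 * n)"
begin

text \<open>The last block has no successor, so the path ends there with an empty
  \<open>wander\<close>.\<close>

definition target :: "nat \<Rightarrow> nat" where
  "target i = \<sigma> (if Suc i < n then Suc i else i)"

definition blk :: "nat \<Rightarrow> step list" where
  "blk i = block n ks (\<sigma> i) (target i)"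

definition steps :: "step list" where
  "steps = concat (map blk [0..<n])"

definition len :: nat where "len = length steps"

definition node :: "nat \<Rightarrow> nat" where
  "node t = (if t < len then fst (steps ! t) else target (n - 1))"

definition crossed :: "nat \<Rightarrow> nat" where
  "crossed t = min (fst (steps ! t)) (fst (snd (steps ! t)))"

definition unmarked :: "nat \<Rightarrow> nat set" where
  "unmarked j = {t. t < len \<and> snd (snd (steps ! t)) = None \<and> crossed t = j}"

text \<open>The leftover mass of a cell, rescaled to 1, is distributed with entropy at most 2
  however many unmarked steps share it.\<close>

definition extra :: "nat \<Rightarrow> nat \<Rightarrow> nat" where
  "extra j = (SOME e. (\<Sum>t\<in>unmarked j. (1/2) ^ e t) = (1::real) \<and>
     (\<Sum>t\<in>unmarked j. e t * (1/2) ^ e t) \<le> (2::real))"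

definition exponent :: "nat \<Rightarrow> nat" where
  "exponent t = (case snd (snd (steps ! t)) of None \<Rightarrow> B + extra (crossed t) t | Some k \<Rightarrow> k)"

abbreviation \<mu> :: "nat \<Rightarrow> nat \<Rightarrow> real" where "\<mu> \<equiv> \<lambda>c k. (1/2) ^ k"

lemma n_gt_0: "0 < n" by (simp add: n_eq)

lemma \<sigma>_less: "i < n \<Longrightarrow> \<sigma> i < n"
  using \<sigma> by (auto simp: bij_betw_def)

lemma target_less: "i < n \<Longrightarrow> target i < n"
  by (simp add: target_def \<sigma>_less)

lemma walk_steps: "walk (\<sigma> 0) steps (target (n - 1))"
proof -
  have "walk (\<sigma> 0) (concat (map blk [0..<Suc i])) (target i)" if "i < n" for i
    using that
  proof (induction i)
    case 0
    then show ?case by (simp add: blk_def walk_block)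
  next
    case (Suc i)
    have "walk (\<sigma> (Suc i)) (blk (Suc i)) (target (Suc i))" by (simp add: blk_def walk_block)
    moreover have "target i = \<sigma> (Suc i)" using Suc.prems by (simp add: target_def)
    moreover have "walk (\<sigma> 0) (concat (map blk [0..<Suc i])) (target i)" using Suc by simp
    ultimately have "walk (\<sigma> 0) (concat (map blk [0..<Suc i]) @ blk (Suc i)) (target (Suc i))"
      by (intro walk_append) simp_all
    then show ?case by simp
  qed
  from this[of "n - 1"] show ?thesis using n_gt_0 by (simp add: steps_def)
qed

lemma node_eq: "t < len \<Longrightarrow> node t = fst (steps ! t)"
  by (simp add: node_def)

lemma node_Suc: "t < len \<Longrightarrow> node (Suc t) = fst (snd (steps ! t))"
  using walk_nth(1)[OF walk_steps, of t] by (auto simp: node_def len_def)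

lemma crossed_eq: "t < len \<Longrightarrow> min (node t) (node (Suc t)) = crossed t"
  by (simp add: node_eq node_Suc crossed_def)

lemma obtain_block:
  assumes "t < len"
  obtains i p q where "i < n" "blk i = p @ steps ! t # q"
    "take t steps = concat (map blk [0..<i]) @ p"
proof -
  have "concat (map blk [0..<n]) = take t steps @ steps ! t # drop (Suc t) steps"
    using assms id_take_nth_drop[of t steps] by (simp add: steps_def len_def)
  from concat_blocks_split[OF this] show ?thesis using that by blast
qed

lemma step_values_le: "t < len \<Longrightarrow> fst (steps ! t) \<le> n \<and> fst (snd (steps ! t)) \<le> n"
proof -
  assume "t < len"
  then obtain i p q where i: "i < n" "blk i = p @ steps ! t # q" by (rule obtain_block)
  then have "steps ! t \<in> set (block n ks (\<sigma> i) (target i))" by (simp add: blk_def[symmetric])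
  from set_block(1,2)[OF \<sigma>_less[OF i(1)] this] \<sigma>_less[OF i(1)] target_less[OF i(1)]
  show ?thesis by auto
qed

lemma total_blocks: "total F (concat (map blk [0..<i])) = (\<Sum>r<i. \<Sum>k\<leftarrow>ks. F (\<sigma> r) k)"
  by (induction i) (auto simp: blk_def total_block)

text \<open>Block \<open>r\<close> marks only cell \<open>\<sigma> r\<close>, and
  \<open>\<sigma>\<close> is a bijection, so each cell receives \<open>ks\<close> exactly
  once.\<close>

lemma total_steps: "total F steps = (\<Sum>j<n. \<Sum>k\<leftarrow>ks. F j k)"
  unfolding steps_def total_blocks by (rule sum.reindex_bij_betw[OF \<sigma>])

lemma blk_split:
  obtains p where "blk i = (\<sigma> i, Suc (\<sigma> i), Some 1) # excursion n (\<sigma> i) @ p"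
proof -
  obtain ks' where "ks = 1 # ks'" using ks by (cases ks) auto
  then have "blk i = (\<sigma> i, Suc (\<sigma> i), Some 1) # excursion n (\<sigma> i) @
      concat (map (\<lambda>k. (\<sigma> i, Suc (\<sigma> i), Some k) # excursion n (\<sigma> i)) ks') @ wander (\<sigma> i) (target i)"
    unfolding blk_def block_def by simp
  then show ?thesis by (rule that)
qed

text \<open>Right after the first marked crossing of block \<open>i\<close>, an excursion visits
  \<open>\<sigma> i\<close> and its neighbours. By then the marked mass of \<open>i\<close> whole
  blocks and the mass 1/2 have passed.\<close>

lemma obtain_excursion_step:
  assumes "i < n" "c < n" "c \<le> Suc (\<sigma> i)" "\<sigma> i \<le> Suc c"
  obtains t where "t < len" "crossed t = c" "snd (snd (steps ! t)) = None"
    "total \<mu> (take t steps) = i * (1 - (1/2) ^ B) + 1/2"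
proof -
  obtain x where x: "x \<in> set (excursion n (\<sigma> i))" "min (fst x) (fst (snd x)) = c"
    using excursion_crosses[OF \<sigma>_less[OF assms(1)] assms(2-4)] by blast
  then obtain p q where pq: "excursion n (\<sigma> i) = p @ x # q" by (meson split_list)
  have None: "snd (snd y) = None" if "y \<in> set (excursion n (\<sigma> i))" for y
    using set_excursion[OF \<sigma>_less[OF assms(1)] that] by simp
  obtain r where "blk i = (\<sigma> i, Suc (\<sigma> i), Some 1) # excursion n (\<sigma> i) @ r" by (rule blk_split)
  then have blk: "blk i = (\<sigma> i, Suc (\<sigma> i), Some 1) # p @ x # q @ r" by (simp add: pq)
  define u where "u = concat (map blk [0..<i]) @ (\<sigma> i, Suc (\<sigma> i), Some 1) # p"
  have "[0..<n] = [0..<i] @ i # [Suc i..<n]"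
    using assms(1) by (metis upt_add_eq_append le_add1 le_add_diff_inverse less_imp_le_nat upt_conv_Cons zero_le)
  then have steps: "steps = u @ x # (q @ r @ concat (map blk [Suc i..<n]))"
    by (simp add: steps_def blk u_def)
  have "total \<mu> p = 0" using None pq by (intro total_unmarked) auto
  then have "total \<mu> u = i * (1 - (1/2) ^ B) + 1/2"
    by (simp add: u_def total_blocks sum_ks weight_def)
  then show ?thesis
    using that[of "length u"] x None[OF x(1)] by (simp add: steps len_def crossed_def)
qed

text \<open>Every cell is \<open>\<sigma> i\<close> for some \<open>i\<close>, and the excursions of
  block \<open>i\<close> cross it. So some step can take up the leftover mass.\<close>

lemma unmarked_nonempty: "j < n \<Longrightarrow> unmarked j \<noteq> {}"
proof -
  assume j: "j < n"
  then have "j \<in> \<sigma> ` {..<n}" using \<sigma> by (simp add: bij_betw_def)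
  then obtain i where i: "i < n" "\<sigma> i = j" by auto
  obtain t where "t < len" "crossed t = j" "snd (snd (steps ! t)) = None"
    using obtain_excursion_step[of i j] i j by auto
  then show ?thesis by (auto simp: unmarked_def)
qed

lemma finite_unmarked: "finite (unmarked j)"
  by (simp add: unmarked_def)

lemma extra:
  assumes "j < n"
  shows "(\<Sum>t\<in>unmarked j. (1/2) ^ extra j t) = (1::real)"
    "(\<Sum>t\<in>unmarked j. extra j t * (1/2) ^ extra j t) \<le> (2::real)"
  using someI_ex[OF dyadic_distribution[OF finite_unmarked unmarked_nonempty[OF assms]]]
  by (simp_all add: extra_def)

lemma crossed_less: "t < len \<Longrightarrow> crossed t < n"
  using walk_nth(2)[OF walk_steps, of t] step_values_le[of t] by (auto simp: crossed_def len_def)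

text \<open>Marked steps are summed by \<open>total_steps\<close>, unmarked ones are grouped by
  cell. Suitable choices of \<open>F\<close> give the mass of a cell and the entropy.\<close>

lemma sum_exponent:
  fixes F :: "nat \<Rightarrow> nat \<Rightarrow> real"
  shows "(\<Sum>t<len. F (crossed t) (exponent t)) =
    (\<Sum>j<n. (\<Sum>k\<leftarrow>ks. F j k) + (\<Sum>t\<in>unmarked j. F j (B + extra j t)))"
proof -
  let ?N = "\<lambda>t. snd (snd (steps ! t)) = None"
  have "(\<Sum>t<len. F (crossed t) (exponent t)) =
      (\<Sum>t<len. weight F (steps ! t) + (if ?N t then F (crossed t) (B + extra (crossed t) t) else 0))"
    by (intro sum.cong) (auto simp: weight_def exponent_def crossed_def split: option.split)
  also have "\<dots> = total F steps + (\<Sum>t\<in>{..<len} \<inter> {t. ?N t}. F (crossed t) (B + extra (crossed t) t))"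
    by (simp add: sum.distrib total_eq_sum len_def sum.inter_restrict)
  also have "(\<Sum>t\<in>{..<len} \<inter> {t. ?N t}. F (crossed t) (B + extra (crossed t) t)) =
      (\<Sum>j<n. \<Sum>t | t \<in> {..<len} \<inter> {t. ?N t} \<and> crossed t = j. F (crossed t) (B + extra (crossed t) t))"
    by (rule sum.group[symmetric]) (auto simp: crossed_less)
  also have "\<dots> = (\<Sum>j<n. \<Sum>t\<in>unmarked j. F j (B + extra j t))"
    by (intro sum.cong) (auto simp: unmarked_def)
  finally show ?thesis by (simp add: total_steps sum.distrib)
qed

lemma unmarked_mass:
  "j < n \<Longrightarrow> (\<Sum>t\<in>unmarked j. (1/2) ^ (B + extra j t)) = (1/2 :: real) ^ B"
  using extra(1)[of j] by (simp add: power_add sum_distrib_left[symmetric])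

lemma exponent_gt_0: "t < len \<Longrightarrow> 1 \<le> exponent t"
proof -
  assume "t < len"
  then obtain i p q where i: "i < n" "blk i = p @ steps ! t # q" by (rule obtain_block)
  then have "steps ! t \<in> set (block n ks (\<sigma> i) (target i))" by (simp add: blk_def[symmetric])
  from set_block(3)[OF \<sigma>_less[OF i(1)] this] show ?thesis
    using ks(3) B by (auto simp: exponent_def)
qed

sublocale crossing_map m n len node exponent
proof
  show "n = 2 ^ m" by (rule n_eq)
  show "node t \<le> n" if "t \<le> len" for t
    using step_values_le[of t] target_less[of "n - 1"] n_gt_0 that by (auto simp: node_def)
  show "node (Suc t) = Suc (node t) \<or> node t = Suc (node (Suc t))" if "t < len" for t
    using walk_nth(2)[OF walk_steps, of t] that by (auto simp: node_eq node_Suc len_def)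
  show "1 \<le> exponent t" if "t < len" for t using that by (rule exponent_gt_0)
  show "2 \<le> exponent t \<or> 2 \<le> exponent (Suc t)" if "Suc t < len" for t
  proof -
    have "unmarked_gaps steps"
      unfolding steps_def by (rule unmarked_gaps_concat) (auto simp: blk_def unmarked_gaps_block \<sigma>_less)
    then have "snd (snd (steps ! t)) = None \<or> snd (snd (steps ! Suc t)) = None"
      using that by (intro unmarked_gaps_nth) (auto simp: len_def)
    then show ?thesis using B(1) by (auto simp: exponent_def)
  qed
  show "(\<Sum>t | t < len \<and> min (node t) (node (Suc t)) = j. (1/2) ^ exponent t) = (1::real)" if j: "j < n" for j
  proof -
    have "(\<Sum>t | t < len \<and> min (node t) (node (Suc t)) = j. (1/2) ^ exponent t) =
        (\<Sum>t\<in>{..<len} \<inter> {t. crossed t = j}. (1/2 :: real) ^ exponent t)"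
      by (intro sum.cong) (auto simp: crossed_eq)
    also have "\<dots> = (\<Sum>t<len. if crossed t = j then (1/2) ^ exponent t else 0)"
      by (simp add: sum.inter_restrict)
    also have "\<dots> = (\<Sum>i<n. (\<Sum>k\<leftarrow>ks. if i = j then (1/2) ^ k else 0) +
        (\<Sum>t\<in>unmarked i. if i = j then (1/2) ^ (B + extra i t) else 0))"
      by (rule sum_exponent[of "\<lambda>c k. if c = j then (1/2) ^ k else 0"])
    \<comment> \<open>In cell \<open>j\<close> the marked mass \<open>1 - (1/2) ^ B\<close> and the
      leftover mass \<open>(1/2) ^ B\<close> add up to 1.\<close>
    also have "\<dots> = (\<Sum>i<n. if i = j then 1 else 0)"
      by (intro sum.cong) (auto simp: sum_ks unmarked_mass)
    also have "\<dots> = 1" using j by simp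
    finally show ?thesis .
  qed
qed

lemma cell_crossed: "t < len \<Longrightarrow> cell t = crossed t"
  by (simp add: cell_def crossed_eq)

text \<open>Marked time is an accurate clock: the unmarked steps of all \<open>n\<close> cells
  together last only \<open>(1/2) ^ B\<close>.\<close>

lemma X_total:
  assumes "t \<le> len"
  shows "total \<mu> (take t steps) / n \<le> X t" "X t \<le> total \<mu> (take t steps) / n + (1/2) ^ B"
proof -
  let ?N = "\<lambda>t. snd (snd (steps ! t)) = None"
  let ?R = "\<lambda>t. if ?N t then (1/2) ^ exponent t else (0::real)"
  have "(\<Sum>r<t. (1/2) ^ exponent r) = (\<Sum>r<t. weight \<mu> (take t steps ! r) + ?R r)"
    by (intro sum.cong) (auto simp: weight_def exponent_def split: option.split)
  also have "\<dots> = total \<mu> (take t steps) + (\<Sum>r<t. ?R r)"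
    using assms by (simp add: sum.distrib total_eq_sum len_def)
  finally have X: "X t = total \<mu> (take t steps) / n + (\<Sum>r<t. ?R r) / n"
    by (simp add: X_def add_divide_distrib)
  have "0 \<le> (\<Sum>r<t. ?R r)" by (intro sum_nonneg) auto
  then show "total \<mu> (take t steps) / n \<le> X t" using X by simp
  have "(\<Sum>r<len. (1/2) ^ exponent r) = (\<Sum>r<len. weight \<mu> (steps ! r) + ?R r)"
    by (intro sum.cong) (auto simp: weight_def exponent_def split: option.split)
  then have "real n = n * (1 - (1/2) ^ B) + (\<Sum>r<len. ?R r)"
    using sum_cells[of "\<lambda>_. 1"] total_steps[of \<mu>]
    by (simp add: sum.distrib total_eq_sum[symmetric] len_def[symmetric] sum_ks total_eq_sum)
  then have "(\<Sum>r<len. ?R r) = n * (1/2) ^ B" by (simp add: algebra_simps)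
  then have "(\<Sum>r<len. ?R r) / n = (1/2) ^ B" using n_gt_0 by simp
  moreover have "(\<Sum>r<t. ?R r) \<le> (\<Sum>r<len. ?R r)"
    using assms by (intro sum_mono2) auto
  then have "(\<Sum>r<t. ?R r) / n \<le> (\<Sum>r<len. ?R r) / n" by (rule divide_right_mono) simp
  ultimately show "X t \<le> total \<mu> (take t steps) / n + (1/2) ^ B" using X by linarith
qed

lemma take_Suc_steps: "t < len \<Longrightarrow> take (Suc t) steps = take t steps @ [steps ! t]"
  by (simp add: take_Suc_conv_app_nth len_def)

text \<open>The crossing starts at marked time \<open>i * (1 - (1/2) ^ B) + 1/2\<close>. The lag
  \<open>i * (1/2) ^ B\<close> is at most 1/2 and the unmarked time at most
  \<open>1 / (2 * n)\<close>, so it stays in time cell \<open>i\<close>.\<close>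

lemma locally_eventually_onto_itinerary: "locally_eventually_onto g"
proof (rule locally_eventually_onto_g[OF \<sigma>])
  fix i c assume ic: "i < n" "c < n" "c \<le> Suc (\<sigma> i)" "\<sigma> i \<le> Suc c"
  obtain t where t: "t < len" "crossed t = c" "snd (snd (steps ! t)) = None"
    "total \<mu> (take t steps) = i * (1 - (1/2) ^ B) + 1/2"
    using obtain_excursion_step[OF ic] .
  have "i * (1/2) ^ B \<le> i * (1 / (2 * n))" using B(2) by (intro mult_left_mono) auto
  also have "\<dots> \<le> n * (1 / (2 * n))" using ic(1) by (intro mult_right_mono) auto
  finally have small: "i * (1/2) ^ B \<le> 1/2" using n_gt_0 by simp
  have "i / n \<le> (i * (1 - (1/2) ^ B) + 1/2) / n"
    using small by (intro divide_right_mono) (auto simp: algebra_simps)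
  also have "\<dots> \<le> X t" using X_total(1)[of t] t by simp
  finally have 1: "i / n \<le> X t" .
  \<comment> \<open>The crossing is itself unmarked and leaves the marked time unchanged.\<close>
  have "X (Suc t) \<le> (i * (1 - (1/2) ^ B) + 1/2) / n + (1/2) ^ B"
    using X_total(2)[of "Suc t"] t by (simp add: take_Suc_steps weight_def)
  also have "\<dots> \<le> (i + 1/2) / n + 1 / (2 * n)"
    using B(2) by (intro add_mono divide_right_mono) (auto simp: algebra_simps)
  also have "\<dots> = Suc i / n" using n_gt_0 by (simp add: field_simps)
  finally have 2: "X (Suc t) \<le> Suc i / n" .
  show "\<exists>t<len. cell t = c \<and> {X t..X (Suc t)} \<subseteq> {i / n..Suc i / n}"
    using t 1 2 by (intro exI[of _ t]) (auto simp: cell_crossed)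
qed

text \<open>Block \<open>i\<close> occupies time cell \<open>i\<close> up to an error
  \<open>(1/2) ^ B\<close>; its heights are within 2 of \<open>\<sigma> i\<close> or on the way to
  \<open>target i\<close>. The uniform estimate rests on this.\<close>

lemma piece_location:
  assumes "t < len"
  obtains i where "i < n" "i / n - (1/2) ^ B \<le> X t" "X (Suc t) \<le> Suc i / n + (1/2) ^ B"
    "\<And>j. j \<in> {node t, node (Suc t)} \<Longrightarrow>
      \<bar>real j - \<sigma> i\<bar> \<le> max 2 \<bar>real (\<sigma> i) - target i\<bar>"
proof -
  obtain i p q where i: "i < n" "blk i = p @ steps ! t # q" "take t steps = concat (map blk [0..<i]) @ p"
    using obtain_block[OF assms] .
  have pos: "0 \<le> total \<mu> s" for s by (rule total_nonneg) simp
  have "total \<mu> (blk i) = 1 - (1/2) ^ B" by (simp add: blk_def total_block sum_ks)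
  then have split: "total \<mu> p + weight \<mu> (steps ! t) + total \<mu> q = 1 - (1/2) ^ B" by (simp add: i(2))
  have tot: "total \<mu> (take t steps) = i * (1 - (1/2) ^ B) + total \<mu> p"
    by (simp add: i(3) total_blocks sum_ks)
  have "real i / n * (1/2) ^ B \<le> 1 * (1/2) ^ B" using i(1) by (intro mult_right_mono) auto
  then have "i / n - (1/2) ^ B \<le> i / n * (1 - (1/2) ^ B)" by (simp add: algebra_simps)
  also have "\<dots> \<le> total \<mu> (take t steps) / n"
    using pos[of p] n_gt_0 by (simp add: tot divide_right_mono)
  also have "\<dots> \<le> X t" using X_total(1)[of t] assms by simp
  finally have 1: "i / n - (1/2) ^ B \<le> X t" .
  have "total \<mu> (take (Suc t) steps) \<le> i * (1 - (1/2) ^ B) + (1 - (1/2) ^ B)"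
    using split pos[of q] tot assms by (simp add: take_Suc_steps)
  also have "\<dots> \<le> i + 1" by (simp add: algebra_simps)
  finally have "total \<mu> (take (Suc t) steps) / n \<le> Suc i / n" by (intro divide_right_mono) auto
  then have 2: "X (Suc t) \<le> Suc i / n + (1/2) ^ B" using X_total(2)[of "Suc t"] assms by simp
  have "steps ! t \<in> set (block n ks (\<sigma> i) (target i))" using i(2) by (simp add: blk_def[symmetric])
  note in_range = set_block(1,2)[OF \<sigma>_less[OF i(1)] this]
  have "\<bar>real j - \<sigma> i\<bar> \<le> max 2 \<bar>real (\<sigma> i) - target i\<bar>"
    if "j \<in> {\<sigma> i - 1..min (\<sigma> i + 2) n} \<union> {min (\<sigma> i) (target i)..max (\<sigma> i) (target i)}" for j
    using that by (auto simp: min_def max_def split: if_split_asm)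
  then have "\<bar>real j - \<sigma> i\<bar> \<le> max 2 \<bar>real (\<sigma> i) - target i\<bar>" if "j \<in> {node t, node (Suc t)}" for j
    using that in_range assms by (auto simp: node_eq node_Suc simp del: Un_iff)
  with i(1) 1 2 show ?thesis by (rule that)
qed

text \<open>The unmarked steps of a cell contribute \<open>(1/2) ^ B * (B + E)\<close>, where
  \<open>E\<close> is the entropy of the distribution \<open>extra\<close>, between 0 and 2.\<close>

lemma entropy_itinerary:
  defines "H \<equiv> (\<Sum>k\<leftarrow>ks. k * (1/2) ^ k) + B * (1/2) ^ B"
  shows "H \<le> entropy_lambda g" "entropy_lambda g \<le> H + 2 * (1/2) ^ B"
proof -
  let ?E = "\<lambda>j. \<Sum>t\<in>unmarked j. extra j t * (1/2 :: real) ^ extra j t"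
  have un: "(\<Sum>t\<in>unmarked j. real (B + extra j t) * (1/2) ^ (B + extra j t)) =
      B * (1/2) ^ B + (1/2) ^ B * ?E j" if "j < n" for j
  proof -
    have "(\<Sum>t\<in>unmarked j. real (B + extra j t) * (1/2) ^ (B + extra j t)) =
        (\<Sum>t\<in>unmarked j. B * (1/2) ^ (B + extra j t) + (1/2) ^ B * (extra j t * (1/2) ^ extra j t))"
      by (intro sum.cong) (auto simp: algebra_simps power_add)
    then show ?thesis
      by (simp only: sum.distrib sum_distrib_left[symmetric] unmarked_mass[OF that])
  qed
  have "(\<Sum>t<len. exponent t * (1/2 :: real) ^ exponent t) = (\<Sum>j<n. H + (1/2) ^ B * ?E j)"
    using sum_exponent[of "\<lambda>c k. real k * (1/2) ^ k"] un by (simp add: H_def add.assoc)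
  then have ent: "entropy_lambda g = (\<Sum>j<n. H + (1/2) ^ B * ?E j) / n" by (simp add: entropy_g)
  have "(\<Sum>j<n. H) \<le> (\<Sum>j<n. H + (1/2) ^ B * ?E j)"
    by (intro sum_mono) (simp add: sum_nonneg)
  then show "H \<le> entropy_lambda g" using n_gt_0 by (simp add: ent field_simps)
  have "(\<Sum>j<n. H + (1/2) ^ B * ?E j) \<le> (\<Sum>j<n. H + (1/2) ^ B * 2)"
    using extra(2) by (intro sum_mono add_mono mult_left_mono) auto
  then show "entropy_lambda g \<le> H + 2 * (1/2) ^ B" using n_gt_0 by (simp add: ent field_simps)
qed

end

subsection \<open>Approximating a measure-preserving map\<close>

text \<open>The masses \<open>1/2, 1/4, \<dots>\<close> have entropy \<open>2\<close>, the least this construction allows. Splitting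
  the remaining mass \<open>2\<^sup>-\<^sup>s\<close> into \<open>2\<^sup>q\<close> equal parts adds \<open>q * 2\<^sup>-\<^sup>s\<close>, which reaches every larger value
  up to \<open>2\<^sup>-\<^sup>s\<close>; one part is left over for the unmarked steps.\<close>

definition exponents :: "nat \<Rightarrow> nat \<Rightarrow> nat list" where
  "exponents s q = [1..<Suc s] @ replicate (2 ^ q - 1) (s + q)"

lemma exponents_start: "1 \<le> s \<Longrightarrow> exponents s q \<noteq> [] \<and> hd (exponents s q) = 1"
  by (simp add: exponents_def upt_conv_Cons del: upt_Suc)

lemma exponents_ge_1: "1 \<le> s \<Longrightarrow> k \<in> set (exponents s q) \<Longrightarrow> 1 \<le> k"
  by (auto simp: exponents_def)

lemma sum_exponents: "(\<Sum>k\<leftarrow>exponents s q. (1/2) ^ k) = 1 - (1/2 :: real) ^ (s + q)"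
proof -
  have "(\<Sum>k\<leftarrow>[1..<Suc s]. (1/2) ^ k) = 1 - (1/2 :: real) ^ s"
    by (induction s) auto
  moreover have "(2 ^ q - 1) * (1/2 :: real) ^ (s + q) = (1/2) ^ s - (1/2) ^ (s + q)"
    by (simp add: power_add power_one_over left_diff_distrib diff_divide_distrib)
  ultimately show ?thesis
    by (simp add: exponents_def sum_list_replicate of_nat_diff del: upt_Suc)
qed

text \<open>The first \<open>s\<close> exponents contribute \<open>2 - (s + 2) * (1/2) ^ s\<close>,
  and the \<open>2 ^ q\<close> equal parts, including the leftover one, contribute
  \<open>(s + q) * (1/2) ^ s\<close>.\<close>

lemma entropy_exponents:
  "(\<Sum>k\<leftarrow>exponents s q. k * (1/2) ^ k) + (s + q) * (1/2) ^ (s + q) = 2 + (real q - 2) * (1/2 :: real) ^ s"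
proof -
  have "(\<Sum>k\<leftarrow>[1..<Suc s]. k * (1/2) ^ k) = 2 - (s + 2) * (1/2 :: real) ^ s"
    by (induction s) (auto simp: field_simps)
  moreover have "(2 ^ q - 1) * ((s + q) * (1/2 :: real) ^ (s + q)) = (s + q) * (1/2) ^ s - (s + q) * (1/2) ^ (s + q)"
    by (simp add: power_add power_one_over left_diff_distrib diff_divide_distrib)
  ultimately show ?thesis
    by (simp add: exponents_def sum_list_replicate of_nat_diff algebra_simps del: upt_Suc)
qed

text \<open>The preimages of \<open>k\<close> grid cells have total length \<open>k / n\<close>, so \<open>k\<close> cells of the domain meet
  the preimages of at least \<open>k\<close> cells: this is Hall's condition.\<close>

lemma cell_matching:
  fixes n :: nat
  assumes h: "h \<in> C_lambda" and n: "0 < n"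
  shows "\<exists>\<sigma>. bij_betw \<sigma> {..<n} {..<n} \<and>
    (\<forall>i<n. \<exists>z\<in>{i / n..Suc i / n}. h z \<in> {\<sigma> i / n..Suc (\<sigma> i) / n})"
proof -
  define I where "I = (\<lambda>i::nat. {i / n..Suc i / n})"
  define N where "N = (\<lambda>i. {j. j < n \<and> (\<exists>z\<in>I i. h z \<in> I j)})"
  have I_sub: "I i \<subseteq> {0..1}" if "i < n" for i
  proof -
    have "Suc i / n \<le> 1" using that by simp
    moreover have "0 \<le> i / n" by simp
    ultimately show ?thesis unfolding I_def by (meson atLeastatMost_subset_iff)
  qed
  have I_cover: "\<exists>j<n. y \<in> I j" if y: "y \<in> {0..1}" for y
  proof (cases "y = 1")
    case True
    then show ?thesis using n by (intro exI[of _ "n - 1"]) (auto simp: I_def divide_simps)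
  next
    case False
    then have "real 0 / n \<le> y" "y < real n / n" using y n by auto
    then obtain j where "j < n" "real j / n \<le> y" "y < Suc j / n" by (rule obtain_subinterval)
    then show ?thesis by (auto simp: I_def)
  qed
  have eI: "emeasure lborel (I i) = ennreal (1 / n)" for i
    by (simp add: I_def divide_right_mono diff_divide_distrib[symmetric])
  have h01: "h z \<in> {0..1}" if "z \<in> {0..1}" for z
    using h that by (auto simp: C_lambda_def PiE_iff simp del: atLeastAtMost_iff)
  have hall: "card S \<le> card (\<Union>i\<in>S. N i)" if S: "S \<subseteq> {..<n}" for S
  proof -
    let ?D = "\<Union>i\<in>S. I i" and ?J = "\<Union>i\<in>S. N i"
    let ?E = "\<Union>j\<in>?J. I j"
    have finS: "finite S" using S by (rule finite_subset) simp
    have J: "?J \<subseteq> {..<n}" by (auto simp: N_def)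
    then have finJ: "finite ?J" by (rule finite_subset) simp
    have D01: "?D \<subseteq> {0..1}" using I_sub S by blast
    have E01: "?E \<subseteq> {0..1}" using I_sub J by blast
    \<comment> \<open>Open cells are disjoint, so their measures add up to a lower bound for
      \<open>?D\<close>; for the closed cells of \<open>?E\<close> subadditivity gives the upper
      bound.\<close>
    have "ennreal (real (card S) / n) = (\<Sum>i\<in>S. emeasure lborel {real i / n<..<Suc i / n})"
      using n by (simp add: diff_divide_distrib[symmetric] divide_right_mono
          ennreal_of_nat_eq_real_of_nat ennreal_mult[symmetric])
    also have "\<dots> = emeasure lborel (\<Union>i\<in>S. {real i / n<..<Suc i / n})"
    proof (rule sum_emeasure)
      show "disjoint_family_on (\<lambda>i. {real i / n<..<Suc i / n}) S"
        unfolding disjoint_family_on_def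
      proof (intro ballI impI)
        fix i j :: nat assume "i \<noteq> j"
        then have "Suc i \<le> j \<or> Suc j \<le> i" by auto
        then have "real (Suc i) / n \<le> real j / n \<or> real (Suc j) / n \<le> real i / n"
          by (metis divide_right_mono of_nat_0_le_iff of_nat_le_iff)
        then show "{real i / n<..<Suc i / n} \<inter> {real j / n<..<Suc j / n} = {}" by auto
      qed
    qed (use finS in auto)
    also have "\<dots> \<le> emeasure lborel ?D"
      using finS by (intro emeasure_mono) (auto simp: I_def intro!: bexI)
    also have "\<dots> = emeasure (lebesgue_on {0..1}) ?D"
      using finS by (subst emeasure_restrict_space[OF _ D01]) (auto simp: I_def)
    \<comment> \<open>Any cell that contains \<open>h z\<close> for some \<open>z\<close> in
      \<open>?D\<close> belongs to \<open>?J\<close>; preservation of measure then replaces the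
      preimage by \<open>?E\<close>.\<close>
    also have "\<dots> \<le> emeasure (lebesgue_on {0..1}) (h -` ?E \<inter> {0..1})"
    proof (rule emeasure_mono)
      show "?D \<subseteq> h -` ?E \<inter> {0..1}"
      proof
        fix z assume "z \<in> ?D"
        then obtain i where i: "i \<in> S" "z \<in> I i" by blast
        then have z: "z \<in> {0..1}" using I_sub S by blast
        then obtain j where "j < n" "h z \<in> I j" using I_cover h01 by blast
        then show "z \<in> h -` ?E \<inter> {0..1}" using i z by (auto simp: N_def)
      qed
      have "closed ?E" by (rule closed_UN[OF finJ]) (simp add: I_def)
      then have "closedin (top_of_set {0..1}) ({0..1} \<inter> h -` ?E)"
        using h by (intro continuous_closedin_preimage) (auto simp: C_lambda_def)
      then have "closed ({0..1} \<inter> h -` ?E)" by (rule closedin_closed_trans) simp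
      then have "{0..1} \<inter> h -` ?E \<in> sets borel" by (rule borel_closed)
      then show "h -` ?E \<inter> {0..1} \<in> sets (lebesgue_on {0..1})"
        by (subst sets_restrict_space_iff) (auto simp: Int_commute)
    qed
    also have "\<dots> = emeasure (lebesgue_on {0..1}) ?E"
    proof -
      have "?E \<in> sets borel" using finJ by (auto simp: I_def)
      then show ?thesis using h E01 by (simp add: C_lambda_def lambda_preserving_def)
    qed
    also have "\<dots> = emeasure lborel ?E"
      using finJ by (subst emeasure_restrict_space[OF _ E01]) (auto simp: I_def)
    also have "\<dots> \<le> (\<Sum>j\<in>?J. emeasure lborel (I j))"
      using finJ by (intro emeasure_subadditive_finite) (auto simp: I_def)
    also have "\<dots> = ennreal (real (card ?J) / n)" by (simp add: eI ennreal_of_nat_eq_real_of_nat ennreal_mult[symmetric])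
    finally have "real (card S) / n \<le> real (card ?J) / n" by simp
    then show ?thesis using n by (simp add: divide_le_cancel)
  qed
  have "\<exists>\<sigma>. inj_on \<sigma> {..<n} \<and> (\<forall>i\<in>{..<n}. \<sigma> i \<in> N i)"
    by (rule hall_marriage) (use hall in \<open>auto simp: N_def\<close>)
  then obtain \<sigma> where \<sigma>: "inj_on \<sigma> {..<n}" "\<And>i. i < n \<Longrightarrow> \<sigma> i \<in> N i" by auto
  have "\<sigma> ` {..<n} \<subseteq> {..<n}" using \<sigma>(2) by (auto simp: N_def)
  then have "bij_betw \<sigma> {..<n} {..<n}" using \<sigma>(1) by (simp add: bij_betw_def endo_inj_surj)
  then show ?thesis using \<sigma>(2) by (intro exI[of _ \<sigma>]) (auto simp: N_def I_def)
qed

theorem theorem18: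
  fixes c \<epsilon> :: real
  assumes "2 \<le> c" and "0 < \<epsilon>"
  shows "dense_in_C_lambda
    {g \<in> thompson_monoid. markov g \<and> locally_eventually_onto g \<and> \<bar>entropy_lambda g - c\<bar> < \<epsilon>}"
    (is "dense_in_C_lambda ?G")
  unfolding dense_in_C_lambda_iff
proof (intro conjI ballI allI impI)
  show "?G \<subseteq> C_lambda" by (auto simp: thompson_monoid_def)
next
  fix h and \<delta> :: real
  assume h: "h \<in> C_lambda" and \<delta>: "0 < \<delta>"
  have "uniformly_continuous_on {0..1} h"
    using h by (intro compact_uniformly_continuous) (auto simp: C_lambda_def)
  then obtain \<eta> where \<eta>: "0 < \<eta>"
    "\<And>x y. x \<in> {0..1} \<Longrightarrow> y \<in> {0..1} \<Longrightarrow> \<bar>x - y\<bar> < \<eta> \<Longrightarrow> \<bar>h x - h y\<bar> < \<delta> / 4"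
    unfolding uniformly_continuous_on_def dist_real_def
    using \<delta> by (metis (no_types) zero_less_divide_iff zero_less_numeral)
  have pow: "\<exists>i. b * (1/2) ^ i < a" if "0 < a" "0 < b" for a b :: real
  proof -
    have "0 < a / b" using that by simp
    then obtain i where "(1/2) ^ i < a / b" using real_arch_pow_inv[of "a / b" "1/2"] by auto
    then show ?thesis using that by (auto simp: field_simps)
  qed
  \<comment> \<open>The final error is \<open>3/4 * \<delta> + 3 / n\<close>, hence
    \<open>12 / n < \<delta>\<close>; the bound by \<open>\<eta>\<close> covers the distance
    \<open>3 / n\<close> in \<open>near\<close>.\<close>
  obtain m where m: "12 * (1/2) ^ m < min \<eta> \<delta>" using pow[of "min \<eta> \<delta>" 12] \<eta>(1) \<delta> by auto
  define n :: nat where "n = 2 ^ m"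
  have n: "0 < n" by (simp add: n_def)
  have n_small: "12 / n < \<eta>" "12 / n < \<delta>" using m by (auto simp: n_def power_one_over)
  obtain s0 where s0: "3 * (1/2) ^ s0 < \<epsilon>" using pow[of \<epsilon> 3] assms by auto
  \<comment> \<open>\<open>s0\<close> controls the entropy error, and \<open>m + 1\<close> makes the
    leftover mass at most \<open>1 / (2 * n)\<close>.\<close>
  define s where "s = s0 + m + 1"
  \<comment> \<open>Then \<open>2 + (q - 2) * (1/2) ^ s\<close> lies below \<open>c\<close> by at
    most \<open>(1/2) ^ s\<close>. The summand 2 also ensures \<open>2 \<le> s + q\<close>.\<close>
  define q where "q = nat \<lfloor>(c - 2) * 2 ^ s\<rfloor> + 2"
  have "(1/2 :: real) ^ s \<le> (1/2) ^ s0" by (rule power_decreasing) (auto simp: s_def)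
  then have s: "3 * (1/2 :: real) ^ s < \<epsilon>" "1 \<le> s" using s0 by (auto simp: s_def)
  obtain \<sigma> where perm: "bij_betw \<sigma> {..<n} {..<n}"
    and meets: "\<And>i. i < n \<Longrightarrow> \<exists>z\<in>{i / n..Suc i / n}. h z \<in> {\<sigma> i / n..Suc (\<sigma> i) / n}"
    using cell_matching[OF h n] by blast
  have sq_small: "(1/2 :: real) ^ (s + q) \<le> 1 / (2 * n)"
  proof -
    have "(1/2 :: real) ^ (s + q) \<le> (1/2) ^ Suc m" by (rule power_decreasing) (auto simp: s_def)
    then show ?thesis by (simp add: n_def power_one_over)
  qed
  interpret itinerary m n "s + q" "exponents s q" \<sigma>
    by unfold_locales
      (use perm s(2) exponents_start exponents_ge_1 sum_exponents sq_small in \<open>auto simp: n_def q_def\<close>)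
  have "\<bar>entropy_lambda g - c\<bar> < \<epsilon>"
  proof -
    define a where "a = (1/2 :: real) ^ s"
    have a: "0 < a" "3 * a < \<epsilon>" "2 ^ s * a = 1" using s by (auto simp: a_def power_one_over)
    have "0 \<le> (c - 2) * 2 ^ s" using assms by simp
    then have q: "real q - 2 \<le> (c - 2) * 2 ^ s" "(c - 2) * 2 ^ s < real q - 1"
      unfolding q_def by linarith+
    have "(real q - 2) * a \<le> (c - 2) * 2 ^ s * a" using q(1) a(1) by (intro mult_right_mono) auto
    moreover have "(c - 2) * 2 ^ s * a \<le> (real q - 1) * a" using q(2) a(1) by (intro mult_right_mono) auto
    moreover have "(c - 2) * 2 ^ s * a = c - 2" using a(3) by (simp add: mult.assoc)
    ultimately have qa: "(real q - 2) * a \<le> c - 2" "c - 2 \<le> (real q - 2) * a + a" by (auto simp: algebra_simps)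
    have "(1/2 :: real) ^ (s + q) \<le> a" unfolding a_def by (rule power_decreasing) auto
    moreover have "2 + (real q - 2) * a \<le> entropy_lambda g"
      "entropy_lambda g \<le> 2 + (real q - 2) * a + 2 * (1/2) ^ (s + q)"
      using entropy_itinerary entropy_exponents[of s q] by (auto simp: a_def)
    \<comment> \<open>The entropy lies between \<open>c - a\<close> and
      \<open>c + 2 * a\<close>.\<close>
    ultimately show ?thesis using qa a(1,2) by (simp add: abs_less_iff)
  qed
  moreover have "rho h g < \<delta>"
  proof -
    \<comment> \<open>The margin \<open>2 / n\<close> absorbs the shift of block \<open>i\<close>
      against time cell \<open>i\<close>.\<close>
    have near: "\<bar>real (\<sigma> i) / n - h z\<bar> \<le> \<delta> / 4 + 1 / n"
      if i: "i < n" and z: "z \<in> {0..1}" "i / n - 2 / n \<le> z" "z \<le> Suc i / n + 2 / n" for i z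
    proof -
      obtain y where y: "y \<in> {i / n..Suc i / n}" "h y \<in> {\<sigma> i / n..Suc (\<sigma> i) / n}"
        using meets[OF i] by blast
      have "0 \<le> i / n" "Suc i / n \<le> 1" using i by auto
      then have y01: "y \<in> {0..1}" using y(1) by (metis atLeastAtMost_iff order_trans)
      have "\<bar>z - y\<bar> \<le> 3 / n" using y(1) z by (auto simp: add_divide_distrib)
      moreover have "3 / real n \<le> 12 / n" by (rule divide_right_mono) auto
      ultimately have "\<bar>z - y\<bar> < \<eta>" using n_small(1) by linarith
      then have "\<bar>h z - h y\<bar> < \<delta> / 4" using \<eta>(2) z(1) y01 by blast
      moreover have "\<bar>real (\<sigma> i) / n - h y\<bar> \<le> 1 / n" using y(2) by (auto simp: add_divide_distrib)
      ultimately show ?thesis by linarith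
    qed
    \<comment> \<open>Both heights are close to the value of \<open>h\<close> at the common endpoint
      \<open>Suc i / n\<close> of consecutive time cells.\<close>
    have target: "\<bar>real (\<sigma> i) / n - target i / n\<bar> \<le> \<delta> / 2 + 2 / n" if i: "i < n" for i
    proof (cases "Suc i < n")
      case True
      have z: "Suc i / n \<in> {0..1}" using i by simp
      have "\<bar>real (\<sigma> i) / n - h (Suc i / n)\<bar> \<le> \<delta> / 4 + 1 / n"
        using i z by (intro near) (auto simp: divide_simps)
      moreover have "\<bar>real (\<sigma> (Suc i)) / n - h (Suc i / n)\<bar> \<le> \<delta> / 4 + 1 / n"
        using True z by (intro near) (auto simp: divide_simps)
      ultimately show ?thesis using True by (simp add: target_def)
    next
      case False
      then show ?thesis using \<delta> by (simp add: target_def)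
    qed
    have "\<bar>h x - g x\<bar> \<le> 3/4 * \<delta> + 3 / n" if x: "x \<in> {0..1}" for x
    proof -
      obtain t where t: "t < len" "X t \<le> x" "x \<le> X (Suc t)" using x by (rule obtain_piece)
      obtain i where i: "i < n" "i / n - (1/2) ^ (s + q) \<le> X t" "X (Suc t) \<le> Suc i / n + (1/2) ^ (s + q)"
        "\<And>j. j \<in> {node t, node (Suc t)} \<Longrightarrow> \<bar>real j - \<sigma> i\<bar> \<le> max 2 \<bar>real (\<sigma> i) - target i\<bar>"
        using piece_location[OF t(1)] by blast
      have "1 / (2 * n) \<le> 2 / n" using n by (simp add: field_simps)
      then have "(1/2) ^ (s + q) \<le> 2 / n" using sq_small by linarith
      then have hx: "\<bar>real (\<sigma> i) / n - h x\<bar> \<le> \<delta> / 4 + 1 / n"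
        using i(2,3) t(2,3) by (intro near[OF i(1) x]) linarith+
      have ends: "\<bar>j / n - real (\<sigma> i) / n\<bar> \<le> \<delta> / 2 + 2 / n" if "j \<in> {node t, node (Suc t)}" for j
      proof -
        have "\<bar>j / n - real (\<sigma> i) / n\<bar> = \<bar>real j - \<sigma> i\<bar> / n"
          by (simp add: diff_divide_distrib[symmetric])
        also have "\<dots> \<le> max 2 \<bar>real (\<sigma> i) - target i\<bar> / n" using i(4)[OF that] by (rule divide_right_mono) simp
        also have "\<dots> = max (2 / n) \<bar>real (\<sigma> i) / n - target i / n\<bar>"
          by (simp add: max_divide_distrib_right diff_divide_distrib[symmetric])
        also have "\<dots> \<le> \<delta> / 2 + 2 / n" using target[OF i(1)] \<delta> by simp
        finally show ?thesis .
      qed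
      \<comment> \<open>\<open>g x\<close> lies between the end heights of its step, both within
        \<open>\<delta> / 2 + 2 / n\<close> of \<open>\<sigma> i / n\<close>; \<open>hx\<close> adds
        the remaining \<open>\<delta> / 4 + 1 / n\<close>.\<close>
      have "g x \<in> closed_segment (node t / n) (node (Suc t) / n)"
        using f_piece_in_cell[OF t] closed_segment_v[OF t(1)] x by simp
      then have "node t / n \<le> g x \<and> g x \<le> node (Suc t) / n \<or> node (Suc t) / n \<le> g x \<and> g x \<le> node t / n"
        by (auto simp: closed_segment_eq_real_ivl split: if_split_asm)
      then show ?thesis using hx ends[of "node t"] ends[of "node (Suc t)"] by auto
    qed
    then have "rho h g \<le> 3/4 * \<delta> + 3 / n" by (rule rho_le[OF h g_in_C_lambda])
    also have "\<dots> < \<delta>" using n_small(2) by simp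
    finally show ?thesis .
  qed
  ultimately show "\<exists>g\<in>?G. rho h g < \<delta>"
    using thompson_monoid_g markov_g locally_eventually_onto_itinerary by blast
qed

end
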